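(* Define the real numbers $$\theta_1:=\sqrt{\frac{3\sqrt{21}+9}{224}},\qquad \theta_3:=\sqrt{\frac{3\sqrt{21}+3\sqrt{7}+7\sqrt{3}+21}{148384}},$$ and let $\theta_2$ be the real root of the polynomial $$f(x)=x^3-\frac{\sqrt{21}-3}{28}x+\frac{21-5\sqrt{21}}{126}\theta_1 .$$ With $i^2=-1$, let $$\begin{aligned} v_1:={}&\Bigl(\bigl(336(\sqrt{7}-\sqrt{21})\theta_1-42\sqrt{21}-42\sqrt{3}-126\sqrt{7}-378\bigr)\theta_2^2\\ &+\bigl(56(3\sqrt{7}-2\sqrt{3}+3)\theta_1+3\sqrt{21}-21\sqrt{3}+9\sqrt{7}+63\bigr)\theta_2\\ &+(168-24\sqrt{21}-56\sqrt{3}+24\sqrt{7})\theta_1+6\sqrt{21}+18\sqrt{3}-6\sqrt{7}-6\Bigr)i\\ &+\bigl(336(\sqrt{7}+\sqrt{21})\theta_1+42\sqrt{21}-42\sqrt{3}-126\sqrt{7}+378\bigr)\theta_2^2\\ &+\bigl(56(3\sqrt{7}-2\sqrt{3}-3)\theta_1-3\sqrt{21}-21\sqrt{3}+9\sqrt{7}-63\bigr)\theta_2\\ &+(24\sqrt{21}-56\sqrt{3}+24\sqrt{7}-168)\theta_1-6\sqrt{21}+18\sqrt{3}-6\sqrt{7}+6,\\[4pt] v_2:={}&\Bigl(\bigl(672(\sqrt{7}-\sqrt{21})\theta_1-168\sqrt{3}+504\bigr)\theta_2^2\\ &+\bigl(28(3\sqrt{21}+5\sqrt{3}-3\sqrt{7}-15)\theta_1-42\sqrt{3}+126\bigr)\theta_2\\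 &+(336-48\sqrt{21}-112\sqrt{3}+48\sqrt{7})\theta_1-12\sqrt{21}-12\sqrt{3}+12\sqrt{7}+36\Bigr)i\\ &-(84\sqrt{21}-252\sqrt{3}-252\sqrt{7}+252)\theta_2^2\\ &+\bigl(84(\sqrt{21}+\sqrt{3}-3\sqrt{7}-1)\theta_1-6\sqrt{21}+18\sqrt{7}\bigr)\theta_2-24\sqrt{3}+24,\\[4pt] v_3:={}&6(\sqrt{7}-\sqrt{3})i+6\sqrt{21}+12\sqrt{3}-12\sqrt{7}-18,\\[4pt] v_4:={}&\Bigl(\bigl(336(\sqrt{7}-\sqrt{21})\theta_1+126\sqrt{21}-42\sqrt{3}-126\sqrt{7}+126\bigr)\theta_2^2\\ &+\bigl(56(6-3\sqrt{21}-2\sqrt{3}+3\sqrt{7})\theta_1-9\sqrt{21}-21\sqrt{3}+9\sqrt{7}+63\bigr)\theta_2\\ &+(168-24\sqrt{21}-56\sqrt{3}+24\sqrt{7})\theta_1+6\sqrt{21}+18\sqrt{3}-6\sqrt{7}-54\Bigr)i\\ &+\bigl(336(\sqrt{21}-3\sqrt{7})\theta_1+42\sqrt{21}-378\sqrt{3}-126\sqrt{7}+378\bigr)\theta_2^2\\ &+\bigl(168(\sqrt{3}-1)\theta_1-3\sqrt{21}+63\sqrt{3}+9\sqrt{7}-63\bigr)\theta_2\\ &+(24\sqrt{21}+168\sqrt{3}-72\sqrt{7}-168)\theta_1+6-6\sqrt{21}-6\sqrt{3}+18\sqrt{7},\\[4pt] v_5:={}&\Bigl(\bigl(672\sqrt{7}\theta_1+84\sqrt{21}-168\sqrt{3}+252\bigr)\theta_2^2\\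 &-\bigl((84\sqrt{21}-140\sqrt{3}+84\sqrt{7}-84)\theta_1-6\sqrt{21}+42\sqrt{3}\bigr)\theta_2\\ &-(112\sqrt{3}\theta_1-48\sqrt{7}\theta_1+12\sqrt{3}-12\sqrt{7}+24)\Bigr)i\\ &+(672\sqrt{7}\theta_1-84\sqrt{21}-168\sqrt{3}-252)\theta_2^2\\ &+\bigl((84\sqrt{21}+140\sqrt{3}-84\sqrt{7}-84)\theta_1-6\sqrt{21}-42\sqrt{3}\bigr)\theta_2\\ &-112\sqrt{3}\theta_1+48\sqrt{7}\theta_1-12\sqrt{3}+12\sqrt{7}+24,\\[4pt] v_6:={}&6(\sqrt{7}-\sqrt{3})i-6\sqrt{21}+18 . \end{aligned}$$ Then $|\phi_0\rangle=\theta_3(v_1,v_2,v_3,v_4,v_5,v_6)^t\in\mathbb{C}^6$ is a (normalized) initial state of a SIC-POVM in dimension $6$ that is invariant under the Heisenberg group: the $36$ vectors $X^aZ^b|\phi_0\rangle$, $a,b\in\{0,\dots,5\}$, define a SIC-POVM; that is, for all $(a,b)\neq(a',b')$ in $\{0,\dots,5\}^2$, $$\bigl|\langle\phi_0|(X^aZ^b)^\dagger X^{a'}Z^{b'}|\phi_0\rangle\bigr|^2=\frac17 .$$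
   Context: On $\mathbb{C}^6$ with standard basis $|0\rangle,\dots,|5\rangle$ (so $(v_1,\dots,v_6)^t=\sum_{j=0}^5 v_{j+1}|j\rangle$), let $\omega_6=\exp(2\pi i/6)$ and $$X=\sum_{j=0}^{5}|j+1 \bmod 6\rangle\langle j|,\qquad Z=\sum_{j=0}^{5}\omega_6^j|j\rangle\langle j|.$$ The Heisenberg group in dimension $6$ is the group generated by $X$ and $Z$. A SIC-POVM (symmetric informationally complete POVM) in dimension $d$ consists of $d^2$ operators $E_j=\frac1d|\phi_j\rangle\langle\phi_j|$ with unit vectors $|\phi_j\rangle\in\mathbb{C}^d$ satisfying $|\langle\phi_j|\phi_k\rangle|^2=\frac{1}{d+1}$ for $j\neq k$.
   Formalization: The denominator 148384 in θ₃ is replaced by 48384: with the printed value |φ₀|² = 48384/148384 ≈ 0.326, so φ₀ is not normalized and the overlaps are not 1/7. The result is stated for every real root θ₂ of f. *)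

theory Defs
  imports
    "HOL-Analysis.Analysis"
    "HOL-Computational_Algebra.Polynomial"
    "HOL-Algebra.Generated_Groups"
    "Jordan_Normal_Form.Matrix"
    "Jordan_Normal_Form.Schur_Decomposition"
begin

section \<open>The Heisenberg group in dimension 6\<close>

definition \<omega>\<^sub>6 :: complex where
  "\<omega>\<^sub>6 = exp (2 * complex_of_real pi * \<i> / 6)"

definition X\<^sub>6 :: "complex mat" where
  "X\<^sub>6 = mat 6 6 (\<lambda>(r, c). if r = (c + 1) mod 6 then 1 else 0)"

definition Z\<^sub>6 :: "complex mat" where
  "Z\<^sub>6 = mat 6 6 (\<lambda>(r, c). if r = c then \<omega>\<^sub>6 ^ c else 0)"

text \<open>The ambient group is GL(6), the group of units of the ring of complex 6 by 6 matrices.\<close>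

definition heisenberg_group :: "complex mat set" where
  "heisenberg_group = generate (units_of (ring_mat TYPE(complex) 6 ())) {X\<^sub>6, Z\<^sub>6}"


section \<open>SIC-POVMs\<close>

text \<open>As in physics, the inner product is conjugate-linear in the first argument, whereas
  \<open>v \<bullet>c w\<close> conjugates the second one.\<close>

definition braket :: "complex vec \<Rightarrow> complex vec \<Rightarrow> complex" where
  "braket \<phi> \<psi> = \<psi> \<bullet>c \<phi>"

definition ketbra :: "complex vec \<Rightarrow> complex vec \<Rightarrow> complex mat" where
  "ketbra \<phi> \<psi> = mat (dim_vec \<phi>) (dim_vec \<psi>) (\<lambda>(r, c). \<phi> $ r * cnj (\<psi> $ c))"

definition povm_element :: "nat \<Rightarrow> complex vec \<Rightarrow> complex mat" where
  "povm_element d \<phi> = (1 / of_nat d) \<cdot>\<^sub>m ketbra \<phi> \<phi>"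

definition is_sic_povm :: "nat \<Rightarrow> 'i set \<Rightarrow> ('i \<Rightarrow> complex mat) \<Rightarrow> bool" where
  "is_sic_povm d J E \<longleftrightarrow>
     d > 0 \<and> finite J \<and> card J = d\<^sup>2 \<and>
     (\<exists>\<phi>. (\<forall>j\<in>J. \<phi> j \<in> carrier_vec d \<and> braket (\<phi> j) (\<phi> j) = 1 \<and> E j = povm_element d (\<phi> j)) \<and>
          (\<forall>j\<in>J. \<forall>k\<in>J. j \<noteq> k \<longrightarrow> (cmod (braket (\<phi> j) (\<phi> k)))\<^sup>2 = 1 / (real d + 1)))"

text \<open>Invariance of a family of operators, as a set, under conjugation by every element of a
  group of unitary matrices.\<close>

definition invariant_under :: "complex mat set \<Rightarrow> 'i set \<Rightarrow> ('i \<Rightarrow> complex mat) \<Rightarrow> bool" where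
  "invariant_under G J E \<longleftrightarrow> (\<forall>g\<in>G. (\<lambda>A. g * A * mat_adjoint g) ` (E ` J) = E ` J)"


section \<open>The initial state\<close>

definition \<theta>\<^sub>1 :: real where
  "\<theta>\<^sub>1 = sqrt ((3 * sqrt 21 + 9) / 224)"

text \<open>The source prints the denominator 148384 here, which is a misprint for 48384: the vector
  with entries \<open>v\<^sub>1\<close>, ..., \<open>v\<^sub>6\<close> below has squared norm
  6048 - 2016 sqrt 3 + 864 sqrt 7 - 864 sqrt 21 for each root of \<open>poly_f\<close>. Its product with
  3 sqrt 21 + 3 sqrt 7 + 7 sqrt 3 + 21 is 48384, so the initial state has norm 1
  exactly for the value used here.\<close>

definition \<theta>\<^sub>3 :: real where
  "\<theta>\<^sub>3 = sqrt ((3 * sqrt 21 + 3 * sqrt 7 + 7 * sqrt 3 + 21) / 48384)"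

definition poly_f :: "real poly" where
  "poly_f = [: (21 - 5 * sqrt 21) / 126 * \<theta>\<^sub>1, - ((sqrt 21 - 3) / 28), 0, 1 :]"

text \<open>The polynomial \<open>poly_f\<close> has three real roots. The entries of the initial state are
  therefore functions of the chosen root \<open>x\<close>.\<close>

definition v\<^sub>1 :: "real \<Rightarrow> complex" where
  "v\<^sub>1 x =
     complex_of_real
       ((336 * (sqrt 7 - sqrt 21) * \<theta>\<^sub>1 - 42 * sqrt 21 - 42 * sqrt 3 - 126 * sqrt 7 - 378) * x\<^sup>2
        + (56 * (3 * sqrt 7 - 2 * sqrt 3 + 3) * \<theta>\<^sub>1 + 3 * sqrt 21 - 21 * sqrt 3 + 9 * sqrt 7 + 63) * x
        + (168 - 24 * sqrt 21 - 56 * sqrt 3 + 24 * sqrt 7) * \<theta>\<^sub>1 + 6 * sqrt 21 + 18 * sqrt 3 - 6 * sqrt 7 - 6) * \<i>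
     + complex_of_real
       ((336 * (sqrt 7 + sqrt 21) * \<theta>\<^sub>1 + 42 * sqrt 21 - 42 * sqrt 3 - 126 * sqrt 7 + 378) * x\<^sup>2
        + (56 * (3 * sqrt 7 - 2 * sqrt 3 - 3) * \<theta>\<^sub>1 - 3 * sqrt 21 - 21 * sqrt 3 + 9 * sqrt 7 - 63) * x
        + (24 * sqrt 21 - 56 * sqrt 3 + 24 * sqrt 7 - 168) * \<theta>\<^sub>1 - 6 * sqrt 21 + 18 * sqrt 3 - 6 * sqrt 7 + 6)"

definition v\<^sub>2 :: "real \<Rightarrow> complex" where
  "v\<^sub>2 x =
     complex_of_real
       ((672 * (sqrt 7 - sqrt 21) * \<theta>\<^sub>1 - 168 * sqrt 3 + 504) * x\<^sup>2
        + (28 * (3 * sqrt 21 + 5 * sqrt 3 - 3 * sqrt 7 - 15) * \<theta>\<^sub>1 - 42 * sqrt 3 + 126) * x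
        + (336 - 48 * sqrt 21 - 112 * sqrt 3 + 48 * sqrt 7) * \<theta>\<^sub>1 - 12 * sqrt 21 - 12 * sqrt 3 + 12 * sqrt 7 + 36) * \<i>
     + complex_of_real
       (- (84 * sqrt 21 - 252 * sqrt 3 - 252 * sqrt 7 + 252) * x\<^sup>2
        + (84 * (sqrt 21 + sqrt 3 - 3 * sqrt 7 - 1) * \<theta>\<^sub>1 - 6 * sqrt 21 + 18 * sqrt 7) * x
        - 24 * sqrt 3 + 24)"

definition v\<^sub>3 :: "real \<Rightarrow> complex" where
  "v\<^sub>3 x =
     complex_of_real
       (6 * (sqrt 7 - sqrt 3)) * \<i>
     + complex_of_real
       (6 * sqrt 21 + 12 * sqrt 3 - 12 * sqrt 7 - 18)"

definition v\<^sub>4 :: "real \<Rightarrow> complex" where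
  "v\<^sub>4 x =
     complex_of_real
       ((336 * (sqrt 7 - sqrt 21) * \<theta>\<^sub>1 + 126 * sqrt 21 - 42 * sqrt 3 - 126 * sqrt 7 + 126) * x\<^sup>2
        + (56 * (6 - 3 * sqrt 21 - 2 * sqrt 3 + 3 * sqrt 7) * \<theta>\<^sub>1 - 9 * sqrt 21 - 21 * sqrt 3 + 9 * sqrt 7 + 63) * x
        + (168 - 24 * sqrt 21 - 56 * sqrt 3 + 24 * sqrt 7) * \<theta>\<^sub>1 + 6 * sqrt 21 + 18 * sqrt 3 - 6 * sqrt 7 - 54) * \<i>
     + complex_of_real
       ((336 * (sqrt 21 - 3 * sqrt 7) * \<theta>\<^sub>1 + 42 * sqrt 21 - 378 * sqrt 3 - 126 * sqrt 7 + 378) * x\<^sup>2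
        + (168 * (sqrt 3 - 1) * \<theta>\<^sub>1 - 3 * sqrt 21 + 63 * sqrt 3 + 9 * sqrt 7 - 63) * x
        + (24 * sqrt 21 + 168 * sqrt 3 - 72 * sqrt 7 - 168) * \<theta>\<^sub>1 + 6 - 6 * sqrt 21 - 6 * sqrt 3 + 18 * sqrt 7)"

definition v\<^sub>5 :: "real \<Rightarrow> complex" where
  "v\<^sub>5 x =
     complex_of_real
       ((672 * sqrt 7 * \<theta>\<^sub>1 + 84 * sqrt 21 - 168 * sqrt 3 + 252) * x\<^sup>2
        - ((84 * sqrt 21 - 140 * sqrt 3 + 84 * sqrt 7 - 84) * \<theta>\<^sub>1 - 6 * sqrt 21 + 42 * sqrt 3) * x
        - (112 * sqrt 3 * \<theta>\<^sub>1 - 48 * sqrt 7 * \<theta>\<^sub>1 + 12 * sqrt 3 - 12 * sqrt 7 + 24)) * \<i>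
     + complex_of_real
       ((672 * sqrt 7 * \<theta>\<^sub>1 - 84 * sqrt 21 - 168 * sqrt 3 - 252) * x\<^sup>2
        + ((84 * sqrt 21 + 140 * sqrt 3 - 84 * sqrt 7 - 84) * \<theta>\<^sub>1 - 6 * sqrt 21 - 42 * sqrt 3) * x
        - 112 * sqrt 3 * \<theta>\<^sub>1 + 48 * sqrt 7 * \<theta>\<^sub>1 - 12 * sqrt 3 + 12 * sqrt 7 + 24)"

definition v\<^sub>6 :: "real \<Rightarrow> complex" where
  "v\<^sub>6 x =
     complex_of_real
       (6 * (sqrt 7 - sqrt 3)) * \<i>
     + complex_of_real
       (- 6 * sqrt 21 + 18)"

definition \<phi>\<^sub>0 :: "real \<Rightarrow> complex vec" where
  "\<phi>\<^sub>0 x = complex_of_real \<theta>\<^sub>3 \<cdot>\<^sub>v vec_of_list [v\<^sub>1 x, v\<^sub>2 x, v\<^sub>3 x, v\<^sub>4 x, v\<^sub>5 x, v\<^sub>6 x]"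

end

theory Submission
  imports Defs
begin

text \<open>Write \<open>g\<close> for the initial state, extended periodically to the integers, and \<open>\<omega> = \<omega>\<^sub>6\<close>. The overlap
  \<open>S(c, n) = \<Sum>r. \<omega>^(n r) * g(r - c) * cnj (g r)\<close> satisfies \<open>|S(c, n)|\<^sup>2 = \<Sum>m. \<omega>^(n m) * T(c, m)\<close> with
  \<open>T(c, m) = \<Sum>k. g(k + m) * cnj (g(k + m + c)) * cnj (g k) * g(k + c)\<close>, so the SIC condition follows from
  \<open>T(c, m) = ([c = 0] + [m = 0]) / 7\<close>.

  Identifying \<open>\<int>/6\<close> with \<open>\<int>/2 \<times> \<int>/3\<close>, the state takes the form
  \<open>e \<otimes> (\<alpha>, \<beta>, 0) + e' \<otimes> (0, 0, \<gamma>)\<close> with orthogonal \<open>e, e'\<close> in dimension 2, up to explicit scalars.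
  Therefore all \<open>T(c, m)\<close> are determined by \<open>|\<alpha>|\<^sup>2\<close>, \<open>|\<beta>|\<^sup>2\<close> and a single linear relation between
  \<open>\<alpha>\<^sup>2 * cnj \<beta>\<close>, \<open>\<beta>\<^sup>2 * cnj \<alpha>\<close> and \<open>cnj (\<alpha> * \<beta>)\<close>, which are identities in a cubic extension of
  the field generated by \<open>\<theta>\<^sub>1\<close> and \<open>sqrt (-3)\<close> and hence hold for every root \<open>\<theta>\<^sub>2\<close>.\<close>

section \<open>The number field\<close>

text \<open>The components 1, 2, 4, 5 of the initial state are multiples of two elements
  \<open>\<alpha> = re\<^sub>1 + im\<^sub>1 * sqrt (-3)\<close> and \<open>\<beta> = re\<^sub>2 + im\<^sub>2 * sqrt (-3)\<close>, where \<open>q = sqrt 21\<close>, \<open>t = \<theta>\<^sub>1\<close> and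
  \<open>x = \<theta>\<^sub>2\<close>.\<close>

definition re\<^sub>1 :: "real \<Rightarrow> real \<Rightarrow> real \<Rightarrow> real" where
  "re\<^sub>1 q t x = 18 - 2*q + (8*q - 56)*t + (3*q - 21 + (56*q - 112)*t)*x
    + (- 42 - 42*q + 112*q*t)*x\<^sup>2"

definition im\<^sub>1 :: "real \<Rightarrow> real \<Rightarrow> real \<Rightarrow> real" where
  "im\<^sub>1 q t x = - 2 + 2*q + (56 - 8*q)*t + (21 + q + 56*t)*x
    + (- 126 - 14*q - 112*q*t)*x\<^sup>2"

definition re\<^sub>2 :: "real \<Rightarrow> real \<Rightarrow> real \<Rightarrow> real" where
  "re\<^sub>2 q t x = 24 + (- 6*q + (84*q - 84)*t)*x + (- 252 - 84*q)*x\<^sup>2"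

definition im\<^sub>2 :: "real \<Rightarrow> real \<Rightarrow> real \<Rightarrow> real" where
  "im\<^sub>2 q t x = - 12 + 4*q + (16*q - 112)*t + (- 42 + (140 - 28*q)*t)*x
    + (- 168 + 224*q*t)*x\<^sup>2"

context
  fixes q t x :: real
  assumes q: "q * q = 21"
    and t: "t * t = 3/224 * q + 9/224"
    and x: "x * (x * x) = 1/28 * (q * x) - 3/28 * x - 1/6 * t + 5/126 * (q * t)"
begin

text \<open>The defining relations again with a trailing factor \<open>y\<close>: after
  \<open>algebra_simps\<close> products are nested to the right, so a relation must also match in
  front of further factors. Together the rules lower every polynomial to degree below 2 in
  \<open>q\<close> and \<open>t\<close> and below 3 in \<open>x\<close>, where identities can be
  read off coefficientwise.\<close>

lemma reduce:
  "q * (q * y) = 21 * y"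
  "t * (t * y) = (3/224 * q + 9/224) * y"
  "x * (x * (x * y)) = (1/28 * (q * x) - 3/28 * x - 1/6 * t + 5/126 * (q * t)) * y"
  using q t x by (simp_all add: mult.assoc[symmetric])

lemmas field_reduce = power2_eq_square algebra_simps add_divide_distrib q t x reduce

lemma norm\<^sub>1: "(re\<^sub>1 q t x)\<^sup>2 + 3 * (im\<^sub>1 q t x)\<^sup>2 = 48 - 672*t + 160*q*t"
  by (simp add: field_reduce re\<^sub>1_def im\<^sub>1_def)

lemma norm\<^sub>2: "(re\<^sub>2 q t x)\<^sup>2 + 3 * (im\<^sub>2 q t x)\<^sup>2 = 144 + 2016*t - 480*q*t"
  by (simp add: field_reduce re\<^sub>2_def im\<^sub>2_def)

text \<open>For \<alpha> and \<beta> as above, \<open>cnj \<alpha> * \<beta>\<close> has this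
  expression as its real part, and the one in \<open>inner_im\<close> as its coefficient of sqrt
  (-3). Both turn out to be free of \<open>x\<close>.\<close>

lemma inner_re:
  "re\<^sub>1 q t x * re\<^sub>2 q t x + 3 * (im\<^sub>1 q t x * im\<^sub>2 q t x) = 180 - 36*q + (48*q - 336)*t"
  by (simp add: field_reduce re\<^sub>1_def im\<^sub>1_def re\<^sub>2_def im\<^sub>2_def)

lemma inner_im:
  "re\<^sub>1 q t x * im\<^sub>2 q t x - im\<^sub>1 q t x * re\<^sub>2 q t x = 12*q - 60 + (48*q - 336)*t"
  by (simp add: field_reduce re\<^sub>1_def im\<^sub>1_def re\<^sub>2_def im\<^sub>2_def)

text \<open>The real part of \<open>alpha_beta_cubic\<close>, with
  \<open>cnj \<alpha> * \<beta>\<close> already replaced by its \<open>x\<close>-free value; only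
  products of at most two components remain. \<open>cubic_im\<close> is the imaginary part divided
  by sqrt 3.\<close>

lemma cubic_re:
  "12*(q - 3) * (re\<^sub>1 q t x * im\<^sub>2 q t x + im\<^sub>1 q t x * re\<^sub>2 q t x)
   = 3 * (re\<^sub>1 q t x * (12*q - 60 + (48*q - 336)*t) - im\<^sub>1 q t x * (180 - 36*q + (48*q - 336)*t))
     - re\<^sub>2 q t x * (180 - 36*q + (48*q - 336)*t)
     + 3 * im\<^sub>2 q t x * (12*q - 60 + (48*q - 336)*t)"
  by (simp add: field_reduce re\<^sub>1_def im\<^sub>1_def re\<^sub>2_def im\<^sub>2_def)

lemma cubic_im:
  "4*(q - 3) * (re\<^sub>1 q t x * re\<^sub>2 q t x - 3 * (im\<^sub>1 q t x * im\<^sub>2 q t x))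
   = re\<^sub>1 q t x * (180 - 36*q + (48*q - 336)*t) + 3 * im\<^sub>1 q t x * (12*q - 60 + (48*q - 336)*t)
     - re\<^sub>2 q t x * (12*q - 60 + (48*q - 336)*t) - im\<^sub>2 q t x * (180 - 36*q + (48*q - 336)*t)"
  by (simp add: field_reduce re\<^sub>1_def im\<^sub>1_def re\<^sub>2_def im\<^sub>2_def)

end

definition \<alpha> :: "real \<Rightarrow> complex" where
  "\<alpha> x = Complex (re\<^sub>1 (sqrt 21) \<theta>\<^sub>1 x) (sqrt 3 * im\<^sub>1 (sqrt 21) \<theta>\<^sub>1 x)"

definition \<beta> :: "real \<Rightarrow> complex" where
  "\<beta> x = Complex (re\<^sub>2 (sqrt 21) \<theta>\<^sub>1 x) (sqrt 3 * im\<^sub>2 (sqrt 21) \<theta>\<^sub>1 x)"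

lemma theta1_square: "\<theta>\<^sub>1 * \<theta>\<^sub>1 = 3/224 * sqrt 21 + 9/224"
  by (simp add: \<theta>\<^sub>1_def flip: power2_eq_square)

lemma root_cube:
  assumes "poly poly_f x = 0"
  shows "x * (x * x) = 1/28 * (sqrt 21 * x) - 3/28 * x - 1/6 * \<theta>\<^sub>1 + 5/126 * (sqrt 21 * \<theta>\<^sub>1)"
  using assms by (simp add: poly_f_def field_simps)

lemma sqrt3_square: "sqrt 3 * (sqrt 3 * y) = 3 * y"
  by (simp flip: mult.assoc)

context
  fixes x :: real
  assumes root: "poly poly_f x = 0"
begin

lemmas field_facts =
  norm\<^sub>1[OF _ theta1_square root_cube[OF root]] norm\<^sub>2[OF _ theta1_square root_cube[OF root]]
  inner_re[OF _ theta1_square root_cube[OF root]] inner_im[OF _ theta1_square root_cube[OF root]]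
  cubic_re[OF _ theta1_square root_cube[OF root]] cubic_im[OF _ theta1_square root_cube[OF root]]

lemma alpha_norm: "\<alpha> x * cnj (\<alpha> x) = 48 - 672 * \<theta>\<^sub>1 + 160 * sqrt 21 * \<theta>\<^sub>1"
  using field_facts(1)
  by (simp add: \<alpha>_def complex_eq_iff power2_eq_square algebra_simps sqrt3_square)

lemma beta_norm: "\<beta> x * cnj (\<beta> x) = 144 + 2016 * \<theta>\<^sub>1 - 480 * sqrt 21 * \<theta>\<^sub>1"
  using field_facts(2)
  by (simp add: \<beta>_def complex_eq_iff power2_eq_square algebra_simps sqrt3_square)

lemma alpha_beta_inner:
  "cnj (\<alpha> x) * \<beta> x = Complex (180 - 36 * sqrt 21 + (48 * sqrt 21 - 336) * \<theta>\<^sub>1)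
     (sqrt 3 * (12 * sqrt 21 - 60 + (48 * sqrt 21 - 336) * \<theta>\<^sub>1))"
proof -
  have "sqrt 3 * (re\<^sub>1 (sqrt 21) \<theta>\<^sub>1 x * im\<^sub>2 (sqrt 21) \<theta>\<^sub>1 x - im\<^sub>1 (sqrt 21) \<theta>\<^sub>1 x * re\<^sub>2 (sqrt 21) \<theta>\<^sub>1 x)
     = sqrt 3 * (12 * sqrt 21 - 60 + (48 * sqrt 21 - 336) * \<theta>\<^sub>1)"
    using field_facts(4) by simp
  with field_facts(3) show ?thesis
    by (simp only: \<alpha>_def \<beta>_def complex_eq_iff complex.sel times_complex.sel cnj.sel
        real_sqrt_mult_self abs_numeral) (simp add: algebra_simps sqrt3_square)
qed

lemma alpha_beta_cubic:
  "\<beta> x * (\<beta> x * cnj (\<alpha> x)) = \<i> * sqrt 3 * \<alpha> x * \<alpha> x * cnj (\<beta> x)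
     - 4 * \<i> * sqrt 3 * (complex_of_real (sqrt 21) - 3) * cnj (\<beta> x) * cnj (\<alpha> x)"
proof -
  define R where "R = 180 - 36 * sqrt 21 + (48 * sqrt 21 - 336) * \<theta>\<^sub>1"
  define I where "I = 12 * sqrt 21 - 60 + (48 * sqrt 21 - 336) * \<theta>\<^sub>1"
  define A where "A = re\<^sub>1 (sqrt 21) \<theta>\<^sub>1 x"
  define A' where "A' = im\<^sub>1 (sqrt 21) \<theta>\<^sub>1 x"
  define B where "B = re\<^sub>2 (sqrt 21) \<theta>\<^sub>1 x"
  define B' where "B' = im\<^sub>2 (sqrt 21) \<theta>\<^sub>1 x"
  have ab: "\<beta> x * cnj (\<alpha> x) = Complex R (sqrt 3 * I)"
    using alpha_beta_inner by (simp add: R_def I_def mult.commute)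
  then have ba: "\<alpha> x * cnj (\<beta> x) = Complex R (- sqrt 3 * I)"
    by (simp add: complex_eq_iff mult.commute)
  have re: "12 * (sqrt 21 - 3) * (A * B' + A' * B) = 3 * (A * I - A' * R) - B * R + 3 * B' * I"
    using field_facts(5) by (simp only: R_def I_def A_def A'_def B_def B'_def) simp
  have im: "4 * (sqrt 21 - 3) * (A * B - 3 * (A' * B')) = A * R + 3 * A' * I - B * I - B' * R"
    using field_facts(6) by (simp only: R_def I_def A_def A'_def B_def B'_def) simp
  \<comment> \<open>The imaginary components of \<alpha> and \<beta> carry a factor
    \<open>sqrt 3\<close>, which is restored here so that the imaginary parts match
    literally.\<close>
  have im': "sqrt 3 * (4 * (sqrt 21 - 3) * (A * B - 3 * (A' * B')))
     = sqrt 3 * (A * R + 3 * A' * I - B * I - B' * R)"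
    unfolding im ..
  have a: "\<alpha> x = Complex A (sqrt 3 * A')" and b: "\<beta> x = Complex B (sqrt 3 * B')"
    by (simp_all add: \<alpha>_def \<beta>_def A_def A'_def B_def B'_def)
  have "\<beta> x * Complex R (sqrt 3 * I) = \<i> * sqrt 3 * (\<alpha> x * Complex R (- sqrt 3 * I))
     - 4 * \<i> * sqrt 3 * (complex_of_real (sqrt 21) - 3) * (cnj (\<beta> x) * cnj (\<alpha> x))"
    unfolding a b using re im' by (simp add: complex_eq_iff algebra_simps sqrt3_square)
  then show ?thesis
    by (simp only: mult.assoc ab ba)
qed

end

section \<open>Overlaps of Weyl-Heisenberg translates\<close>

lemma periodic_mod:
  fixes h :: "int \<Rightarrow> 'a"
  assumes "\<And>k. h (k + d) = h k"
  shows "h (k mod d) = h k"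
proof -
  have mult: "h (k + d * int n) = h k" for k n
  proof (induction n)
    case (Suc n)
    then show ?case using assms[of "k + d * int n"] by (simp add: algebra_simps)
  qed simp
  show ?thesis
  proof (cases "k div d \<ge> 0")
    case True
    then show ?thesis
      using mult[of "k mod d" "nat (k div d)"] by (simp add: add.commute)
  \<comment> \<open>For a negative quotient the induction on natural multiples is run upwards, from
    \<open>k\<close> to \<open>k mod d\<close>.\<close>
  next
    case False
    then show ?thesis
      using mult[of k "nat (- (k div d))"] by (simp add: minus_mult_div_eq_mod)
  qed
qed

text \<open>Translation by \<open>c\<close> permutes the residues modulo \<open>d\<close>, and
  \<open>h\<close> depends only on the residue.\<close>

lemma sum_periodic_shift:
  fixes h :: "int \<Rightarrow> 'a::comm_monoid_add"
  assumes "d > 0" and per: "\<And>k. h (k + d) = h k"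
  shows "(\<Sum>k\<in>{0..<d}. h (k + c)) = (\<Sum>k\<in>{0..<d}. h k)"
proof -
  have inj: "inj_on (\<lambda>k. (k + c) mod d) {0..<d}"
  proof (rule inj_onI)
    fix k l assume kl: "k \<in> {0..<d}" "l \<in> {0..<d}" and "(k + c) mod d = (l + c) mod d"
    then have "(k + c - c) mod d = (l + c - c) mod d" by (rule_tac mod_diff_cong) auto
    with kl show "k = l" by simp
  qed
  have "(\<lambda>k. (k + c) mod d) ` {0..<d} = {0..<d}"
    by (rule endo_inj_surj[OF _ _ inj]) (use \<open>d > 0\<close> in auto)
  with inj have "bij_betw (\<lambda>k. (k + c) mod d) {0..<d} {0..<d}" by (simp add: bij_betw_def)
  from sum.reindex_bij_betw[OF this, of h] show ?thesis
    by (simp add: periodic_mod[of h, OF per])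
qed

section \<open>Fourth-order correlations and squared overlaps\<close>

definition corr :: "int \<Rightarrow> (int \<Rightarrow> complex) \<Rightarrow> int \<Rightarrow> int \<Rightarrow> complex" where
  "corr d g c m = (\<Sum>k\<in>{0..<d}. g (k + m) * cnj (g (k + m + c)) * cnj (g k) * g (k + c))"

context
  fixes d :: int and g :: "int \<Rightarrow> complex"
  assumes d: "d > 0" and per: "\<And>k. g (k + d) = g k"
begin

lemma periodic_simps:
  "g (k + d) = g k" "g (k + d + l) = g (k + l)" "g (k + l + d) = g (k + l)"
  "g (k + d - l) = g (k - l)" "g (k + d + l - m) = g (k + l - m)" "g (k + d + l + m) = g (k + l + m)"
  using per[of k] per[of "k + l"] per[of "k - l"] per[of "k + l - m"] per[of "k + l + m"]
  by (simp_all add: algebra_simps)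

lemma corr_commute: "corr d g m c = corr d g c m"
  by (simp add: corr_def ac_simps)

text \<open>The substitution of \<open>k + c\<close> for \<open>k\<close> exchanges the conjugated
  factors with the unconjugated ones.\<close>

lemma corr_uminus: "corr d g (- c) m = cnj (corr d g c m)"
proof -
  define h where "h k = g (k + m) * cnj (g (k + m - c)) * cnj (g k) * g (k - c)" for k
  have "corr d g (- c) m = sum h {0..<d}"
    by (simp add: corr_def h_def)
  also have "\<dots> = (\<Sum>k\<in>{0..<d}. h (k + c))"
    by (rule sum_periodic_shift[OF d, symmetric]) (simp add: h_def periodic_simps)
  also have "\<dots> = cnj (corr d g c m)"
    unfolding corr_def cnj_sum by (rule sum.cong) (simp_all add: h_def algebra_simps)
  finally show ?thesis .
qed

lemma corr_periodic: "corr d g (c + d) m = corr d g c m"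
  by (simp add: corr_def periodic_simps flip: add.assoc)

lemma corr_mod: "corr d g (c mod d) (m mod d) = corr d g c m"
proof -
  have "corr d g (c mod d) (m mod d) = corr d g c (m mod d)"
    using periodic_mod[of "\<lambda>c. corr d g c (m mod d)"] corr_periodic by simp
  also have "\<dots> = corr d g c m"
    using periodic_mod[of "\<lambda>m. corr d g m c"] corr_periodic by (simp add: corr_commute)
  finally show ?thesis .
qed

text \<open>A Wiener-Khinchin argument: the squared modulus is a double sum over \<open>r\<close>
  and \<open>r'\<close>; grouping by the difference \<open>m\<close> of the indices leaves the phase
  \<open>w powi (n * m)\<close> times an autocorrelation.\<close>

lemma overlap_fourier:
  assumes w: "w powi d = 1" "norm w = 1"
  shows "complex_of_real ((cmod (\<Sum>r\<in>{0..<d}. w powi (n * r) * g (r - a') * cnj (g (r - a))))\<^sup>2)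
     = (\<Sum>m\<in>{0..<d}. w powi (n * m) * corr d g (a' - a) m)"
proof -
  have w0: "w \<noteq> 0" using w(2) by auto
  have cnj_w: "cnj w = inverse w"
    using w(2) w0 by (metis complex_norm_square inverse_unique mult.commute of_real_1 one_power2)
  have wd: "w powi (n * d) = 1" using w(1) by (metis mult.commute power_int_1_left power_int_mult)
  define f where "f r = w powi (n * r) * g (r - a') * cnj (g (r - a))" for r
  have f_per: "f (r + d) = f r" for r
    using w0 wd by (simp add: f_def periodic_simps ring_distribs power_int_add)
  have "complex_of_real ((cmod (sum f {0..<d}))\<^sup>2) = sum f {0..<d} * cnj (sum f {0..<d})"
    by (rule complex_norm_square)
  also have "\<dots> = (\<Sum>r'\<in>{0..<d}. \<Sum>r\<in>{0..<d}. f r * cnj (f r'))"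
    by (simp flip: sum_distrib_left sum_distrib_right)
  \<comment> \<open>For fixed \<open>r'\<close>, the variable \<open>r\<close> is replaced by
    \<open>m + r'\<close>; periodicity of \<open>f\<close> keeps the range of summation.\<close>
  also have "\<dots> = (\<Sum>r'\<in>{0..<d}. \<Sum>m\<in>{0..<d}. f (m + r') * cnj (f r'))"
    by (intro sum.cong refl sum_periodic_shift[OF d, symmetric]) (simp add: f_per)
  also have "\<dots> = (\<Sum>m\<in>{0..<d}. w powi (n * m) * (\<Sum>r\<in>{0..<d}.
      g (r - a' + m) * cnj (g (r - a' + m + (a' - a))) * cnj (g (r - a')) * g (r - a' + (a' - a))))"
  proof (subst sum.swap, unfold sum_distrib_left, intro sum.cong refl)
    fix m r
    have "w powi (n * (m + r)) * cnj (w powi (n * r)) = w powi (n * m)"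
      using w0 by (simp add: cnj_w ring_distribs power_int_add power_int_inverse)
    then show "f (m + r) * cnj (f r) = w powi (n * m) *
      (g (r - a' + m) * cnj (g (r - a' + m + (a' - a))) * cnj (g (r - a')) * g (r - a' + (a' - a)))"
      by (simp add: f_def algebra_simps)
  qed
  also have "\<dots> = (\<Sum>m\<in>{0..<d}. w powi (n * m) * corr d g (a' - a) m)"
  proof (intro sum.cong refl arg_cong2[where f = "(*)"])
    fix m
    show "(\<Sum>r\<in>{0..<d}. g (r - a' + m) * cnj (g (r - a' + m + (a' - a))) * cnj (g (r - a')) *
        g (r - a' + (a' - a))) = corr d g (a' - a) m"
      unfolding corr_def
      using sum_periodic_shift[OF d, of "\<lambda>k. g (k + m) * cnj (g (k + m + (a' - a))) * cnj (g k) * g (k + (a' - a))" "- a'"]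
      by (simp add: periodic_simps)
  qed
  finally show ?thesis unfolding f_def .
qed

text \<open>Advancing the index by one permutes the summands and multiplies the sum by
  \<open>w powi n\<close>, so the sum vanishes unless this factor is 1.\<close>

lemma sum_root_of_unity:
  fixes w :: complex
  assumes "w powi d = 1" "norm w = 1"
  shows "(\<Sum>m\<in>{0..<d}. w powi (n * m)) = (if w powi n = 1 then of_int d else 0)"
proof (cases "w powi n = 1")
  case True
  then have "w powi (n * m) = 1" for m by (metis power_int_1_left power_int_mult)
  with True d show ?thesis by simp
next
  case False
  have w0: "w \<noteq> 0" using assms(2) by auto
  have per: "w powi (n * (m + d)) = w powi (n * m)" for m
    using w0 assms(1) by (simp add: ring_distribs power_int_add) (metis mult.commute power_int_1_left power_int_mult)
  have "(\<Sum>m\<in>{0..<d}. w powi (n * m)) = (\<Sum>m\<in>{0..<d}. w powi (n * (m + 1)))"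
    by (rule sum_periodic_shift[OF d, symmetric]) (rule per)
  also have "\<dots> = w powi n * (\<Sum>m\<in>{0..<d}. w powi (n * m))"
    using w0 by (simp add: ring_distribs power_int_add sum_distrib_left mult.commute)
  finally show ?thesis using False by simp
qed

text \<open>The values prescribed for the fourth-order correlations are the discrete Fourier transform of
  the SIC condition, so that no root of unity has to be evaluated.\<close>

lemma overlap_if_corr:
  assumes w: "w powi d = 1" "norm w = 1"
    and corr: "\<And>c m. corr d g c m = (of_bool (d dvd c) + of_bool (d dvd m)) / (of_int d + 1)"
  shows "(cmod (\<Sum>r\<in>{0..<d}. w powi (n * r) * g (r - a') * cnj (g (r - a))))\<^sup>2
     = (if d dvd a' - a \<and> w powi n = 1 then 1 else 1 / (of_int d + 1))"
proof -
  let ?D = "of_int d + 1 :: complex"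
  \<comment> \<open>Only \<open>m = 0\<close> is divisible by \<open>d\<close> within one period, so
    the Fourier sum of that indicator is 1.\<close>
  have "{0..<d} = insert 0 {1..<d}" using d by auto
  moreover have "(\<Sum>m\<in>{1..<d}. w powi (n * m) * of_bool (d dvd m)) = 0"
    by (rule sum.neutral) (simp add: zdvd_not_zless)
  ultimately have one: "(\<Sum>m\<in>{0..<d}. w powi (n * m) * of_bool (d dvd m)) = 1"
    by (simp del: sum_mult_of_bool_eq)
  have "complex_of_real ((cmod (\<Sum>r\<in>{0..<d}. w powi (n * r) * g (r - a') * cnj (g (r - a))))\<^sup>2)
    = (\<Sum>m\<in>{0..<d}. w powi (n * m) * of_bool (d dvd a' - a) + w powi (n * m) * of_bool (d dvd m)) / ?D"
    unfolding overlap_fourier[OF w] corr sum_divide_distrib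
    by (rule sum.cong) (simp_all only: ring_distribs times_divide_eq_right)
  also have "\<dots> = ((\<Sum>m\<in>{0..<d}. w powi (n * m)) * of_bool (d dvd a' - a) + 1) / ?D"
    by (simp only: sum.distrib one sum_distrib_right)
  also have "\<dots> = complex_of_real (if d dvd a' - a \<and> w powi n = 1 then 1 else 1 / (of_int d + 1))"
  proof -
    have "complex_of_int (d + 1) \<noteq> 0" unfolding of_int_eq_0_iff using d by simp
    then have "?D \<noteq> 0" by simp
    then show ?thesis unfolding sum_root_of_unity[OF w] by simp
  qed
  finally show ?thesis unfolding of_real_eq_iff .
qed

end

section \<open>The fourth-order correlations of the initial state\<close>

text \<open>With \<open>r = \<i>\<close>, \<open>s = sqrt 3\<close>, \<open>q = sqrt 21\<close>, the lists below contain the unnormalized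
  initial state and its complex conjugate; \<open>a'\<close> and \<open>b'\<close> play the roles of the conjugates of
  \<open>a\<close> and \<open>b\<close>.\<close>

definition state :: "complex \<Rightarrow> complex \<Rightarrow> complex \<Rightarrow> complex \<Rightarrow> complex \<Rightarrow> complex list" where
  "state a b q r s = [s * (1 + r) * a, (1 - s) * b, s * (1 + r) * (1 - s) * ((3 - q) * (1 + r * s)),
     (1 - s) * r * s * a, (1 - r) * b, - 2 * r * s * ((3 - q) * (1 + r * s))]"

definition costate :: "complex \<Rightarrow> complex \<Rightarrow> complex \<Rightarrow> complex \<Rightarrow> complex \<Rightarrow> complex list" where
  "costate a' b' q r s = [s * (1 - r) * a', (1 - s) * b', s * (1 - r) * (1 - s) * ((3 - q) * (1 - r * s)),
     - ((1 - s) * r * s * a'), (1 + r) * b', 2 * r * s * ((3 - q) * (1 - r * s))]"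

text \<open>The correlation for period 6 with the conjugated values supplied as a second list. It is
  then a polynomial in independent ring elements, and all facts about conjugation enter as rewrite
  rules.\<close>

definition bicorr :: "complex list \<Rightarrow> complex list \<Rightarrow> int \<Rightarrow> int \<Rightarrow> complex" where
  "bicorr v w c m = (\<Sum>k\<in>{0..<6}. v ! nat ((k + m) mod 6) * w ! nat ((k + m + c) mod 6)
     * w ! nat (k mod 6) * v ! nat ((k + c) mod 6))"

lemma residues_6: "{0..<6} = {0, 1, 2, 3, 4, 5 :: int}"
  by auto

lemma bicorr_expand:
  "bicorr v w c m = (\<Sum>k\<leftarrow>[0,1,2,3,4,5]. v ! nat ((k + m) mod 6) * w ! nat ((k + m + c) mod 6)
     * w ! nat (k mod 6) * v ! nat ((k + c) mod 6))"
  by (simp add: bicorr_def residues_6 add.assoc)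

context
  fixes a a' b b' q r s :: complex
  assumes q: "q * q = 21" and s: "s * s = 3" and r: "r * r = - 1"
    and norm_sum: "b * b' = 288 - 3 * (a * a')"
    and norm_prod: "a * (a * (a' * a')) = 96 * (a * a') - 2304 * (10 - 2 * q)"
    and cubic: "a' * (b * b) = r * s * a * a * b' - 4 * r * s * (q - 3) * a' * b'"
    and cubic': "a * (b' * b') = - r * s * a' * a' * b + 4 * r * s * (q - 3) * a * b"
begin

text \<open>As for \<open>reduce\<close>, the relations are repeated with a trailing factor. They
  eliminate \<open>b * b'\<close>, squares of \<open>a * a'\<close>, \<open>a' * b * b\<close> and
  \<open>a * b' * b'\<close>. Given \<open>norm_sum\<close>, the relation \<open>norm_prod\<close>
  says that \<open>a * a' * b * b'\<close> equals \<open>6912 * (10 - 2 * q)\<close>;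
  \<theta>\<open>\<^sub>1\<close> no longer occurs.\<close>

lemma reduce_state:
  "q * (q * y) = 21 * y" "s * (s * y) = 3 * y" "r * (r * y) = - y"
  "b * (b' * y) = (288 - 3 * (a * a')) * y"
  "a * (a * (a' * (a' * y))) = (96 * (a * a') - 2304 * (10 - 2 * q)) * y"
  "a' * (b * (b * y)) = (r * s * a * a * b' - 4 * r * s * (q - 3) * a' * b') * y"
  "a * (b' * (b' * y)) = (- r * s * a' * a' * b + 4 * r * s * (q - 3) * a * b) * y"
  using q s r norm_sum norm_prod cubic cubic' by (simp_all flip: mult.assoc)

abbreviation "bicorr_state \<equiv> bicorr (state a b q r s) (costate a' b' q r s)"

lemmas bicorr_eval = bicorr_expand state_def costate_def power2_eq_square algebra_simps
  q s r norm_sum norm_prod cubic cubic' reduce_state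

text \<open>The quantity \<open>(6 - 2 * s) * (1008 - 144 * q)\<close> is the squared norm of the
  unnormalized state. The ten pairs with \<open>0 \<le> c \<le> m \<le> 3\<close> represent all
  pairs modulo 6 up to exchanging \<open>c\<close> and \<open>m\<close> and changing signs.\<close>

lemma bicorr_values:
  "7 * bicorr_state 0 0 = 2 * ((6 - 2 * s) * (1008 - 144 * q))\<^sup>2"
  "7 * bicorr_state 0 1 = ((6 - 2 * s) * (1008 - 144 * q))\<^sup>2"
  "7 * bicorr_state 0 2 = ((6 - 2 * s) * (1008 - 144 * q))\<^sup>2"
  "7 * bicorr_state 0 3 = ((6 - 2 * s) * (1008 - 144 * q))\<^sup>2"
  "bicorr_state 1 1 = 0" "bicorr_state 1 2 = 0" "bicorr_state 1 3 = 0"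
  "bicorr_state 2 2 = 0" "bicorr_state 2 3 = 0" "bicorr_state 3 3 = 0"
  by (simp_all add: bicorr_eval)

end

section \<open>From the formal state to the initial state\<close>

definition fiducial :: "real \<Rightarrow> int \<Rightarrow> complex" where
  "fiducial x k = \<phi>\<^sub>0 x $ nat (k mod 6)"

lemma sqrt21: "sqrt 21 = sqrt 3 * sqrt 7"
  by (simp flip: real_sqrt_mult)

text \<open>Both sides agree coefficientwise as polynomials in \<open>x\<close> and
  \<open>\<theta>\<^sub>1\<close>, by sqrt 21 = sqrt 3 * sqrt 7 and the square of sqrt 3; hence they
  agree for every real \<open>x\<close>, root or not.\<close>

lemma \<phi>\<^sub>0_factor:
  "v\<^sub>1 x = sqrt 3 * (1 + \<i>) * \<alpha> x"
  "v\<^sub>2 x = (1 - sqrt 3) * \<beta> x"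
  "v\<^sub>3 x = sqrt 3 * (1 + \<i>) * (1 - sqrt 3) * ((3 - sqrt 21) * (1 + \<i> * sqrt 3))"
  "v\<^sub>4 x = (1 - sqrt 3) * \<i> * sqrt 3 * \<alpha> x"
  "v\<^sub>5 x = (1 - \<i>) * \<beta> x"
  "v\<^sub>6 x = - 2 * \<i> * sqrt 3 * ((3 - sqrt 21) * (1 + \<i> * sqrt 3))"
  unfolding v\<^sub>1_def v\<^sub>2_def v\<^sub>3_def v\<^sub>4_def v\<^sub>5_def v\<^sub>6_def \<alpha>_def \<beta>_def
    re\<^sub>1_def im\<^sub>1_def re\<^sub>2_def im\<^sub>2_def sqrt21
  by (simp_all add: complex_eq_iff algebra_simps sqrt3_square)

lemma theta3_normalizes:
  "\<theta>\<^sub>3\<^sup>2 * ((6 - 2 * sqrt 3) * (1008 - 144 * sqrt 21)) = 1"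
proof -
  have \<theta>: "\<theta>\<^sub>3\<^sup>2 = (3 * sqrt 21 + 3 * sqrt 7 + 7 * sqrt 3 + 21) / 48384"
    unfolding \<theta>\<^sub>3_def by (rule real_sqrt_pow2) simp
  have "sqrt 7 * (sqrt 7 * y) = 7 * y" for y by (simp flip: mult.assoc)
  then show ?thesis
    unfolding \<theta> sqrt21 by (simp add: algebra_simps sqrt3_square add_divide_distrib)
qed

lemma \<phi>\<^sub>0_carrier: "\<phi>\<^sub>0 x \<in> carrier_vec 6"
  unfolding \<phi>\<^sub>0_def by (intro smult_carrier_vec[THEN iffD2] carrier_vecI) (simp del: vec_of_list_Cons)

lemma \<phi>\<^sub>0_fiducial: "i < 6 \<Longrightarrow> \<phi>\<^sub>0 x $ i = fiducial x (int i)"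
  by (simp add: fiducial_def)

lemma fiducial_periodic: "fiducial x (k + 6) = fiducial x k"
  by (simp add: fiducial_def)

lemma fiducial_state:
  "fiducial x k = \<theta>\<^sub>3 * state (\<alpha> x) (\<beta> x) (sqrt 21) \<i> (sqrt 3) ! nat (k mod 6)"
  "cnj (fiducial x k) = \<theta>\<^sub>3 * costate (cnj (\<alpha> x)) (cnj (\<beta> x)) (sqrt 21) \<i> (sqrt 3) ! nat (k mod 6)"
proof -
  have "\<phi>\<^sub>0 x $ i = \<theta>\<^sub>3 * [v\<^sub>1 x, v\<^sub>2 x, v\<^sub>3 x, v\<^sub>4 x, v\<^sub>5 x, v\<^sub>6 x] ! i" if "i < 6" for i
  proof -
    have "i < dim_vec (vec_of_list [v\<^sub>1 x, v\<^sub>2 x, v\<^sub>3 x, v\<^sub>4 x, v\<^sub>5 x, v\<^sub>6 x])"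
      unfolding dim_vec_of_list using that by simp
    then show ?thesis unfolding \<phi>\<^sub>0_def by (simp only: index_smult_vec vec_of_list_index)
  qed
  then have "fiducial x k = \<theta>\<^sub>3 * [v\<^sub>1 x, v\<^sub>2 x, v\<^sub>3 x, v\<^sub>4 x, v\<^sub>5 x, v\<^sub>6 x] ! nat (k mod 6)"
    by (simp add: fiducial_def)
  moreover have "k mod 6 \<in> {0, 1, 2, 3, 4, 5}"
    unfolding residues_6[symmetric] by simp
  ultimately show "fiducial x k = \<theta>\<^sub>3 * state (\<alpha> x) (\<beta> x) (sqrt 21) \<i> (sqrt 3) ! nat (k mod 6)"
    "cnj (fiducial x k) = \<theta>\<^sub>3 * costate (cnj (\<alpha> x)) (cnj (\<beta> x)) (sqrt 21) \<i> (sqrt 3) ! nat (k mod 6)"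
    by (auto simp: \<phi>\<^sub>0_factor state_def costate_def)
qed

lemma corr_bicorr:
  "corr 6 (fiducial x) c m = complex_of_real (\<theta>\<^sub>3 ^ 4) *
     bicorr (state (\<alpha> x) (\<beta> x) (sqrt 21) \<i> (sqrt 3))
       (costate (cnj (\<alpha> x)) (cnj (\<beta> x)) (sqrt 21) \<i> (sqrt 3)) c m"
  \<comment> \<open>The conjugated values are rewritten first; otherwise the rule for
    \<open>fiducial x k\<close> would act below \<open>cnj\<close>.\<close>
  unfolding corr_def bicorr_def fiducial_state(2)
  unfolding fiducial_state(1) sum_distrib_left
  by (rule sum.cong) (simp_all add: power4_eq_xxxx)

lemma corr_fiducial:
  assumes root: "poly poly_f x = 0"
  shows "corr 6 (fiducial x) c m = (of_bool (6 dvd c) + of_bool (6 dvd m)) / (of_int 6 + 1)"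
    (is "?P c m")
proof -
  let ?N = "(6 - 2 * complex_of_real (sqrt 3)) * (1008 - 144 * complex_of_real (sqrt 21))"
  have "complex_of_real (\<theta>\<^sub>3\<^sup>2 * ((6 - 2 * sqrt 3) * (1008 - 144 * sqrt 21))) = 1"
    unfolding theta3_normalizes by simp
  then have "(complex_of_real (\<theta>\<^sub>3\<^sup>2) * ?N)\<^sup>2 = 1" by simp
  then have N: "complex_of_real (\<theta>\<^sub>3 ^ 4) * ?N\<^sup>2 = 1"
    by (simp add: power_mult_distrib flip: power_mult)
  have s: "complex_of_real (sqrt 3) * complex_of_real (sqrt 3) = 3"
    and q: "complex_of_real (sqrt 21) * complex_of_real (sqrt 21) = 21"
    by (simp_all flip: of_real_mult)
  have norm_sum: "\<beta> x * cnj (\<beta> x) = 288 - 3 * (\<alpha> x * cnj (\<alpha> x))"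
    unfolding alpha_norm[OF root] beta_norm[OF root] by simp
  have norm_prod: "\<alpha> x * (\<alpha> x * (cnj (\<alpha> x) * cnj (\<alpha> x)))
    = 96 * (\<alpha> x * cnj (\<alpha> x)) - 2304 * (10 - 2 * complex_of_real (sqrt 21))"
  proof -
    \<comment> \<open>The quadratic equation satisfied by the squared modulus of \<alpha>; it
      follows from the value of the square of \<open>\<theta>\<^sub>1\<close>.\<close>
    have "(48 - 672 * \<theta>\<^sub>1 + 160 * sqrt 21 * \<theta>\<^sub>1) * (48 - 672 * \<theta>\<^sub>1 + 160 * sqrt 21 * \<theta>\<^sub>1)
      = 96 * (48 - 672 * \<theta>\<^sub>1 + 160 * sqrt 21 * \<theta>\<^sub>1) - 2304 * (10 - 2 * sqrt 21)"
      by (simp add: field_reduce[OF _ theta1_square root_cube[OF root]])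
    from arg_cong[OF this, of complex_of_real]
    have "(\<alpha> x * cnj (\<alpha> x)) * (\<alpha> x * cnj (\<alpha> x))
      = 96 * (\<alpha> x * cnj (\<alpha> x)) - 2304 * (10 - 2 * complex_of_real (sqrt 21))"
      unfolding alpha_norm[OF root] by simp
    then show ?thesis by (simp add: ac_simps)
  qed
  have cubic: "cnj (\<alpha> x) * (\<beta> x * \<beta> x) = \<i> * sqrt 3 * \<alpha> x * \<alpha> x * cnj (\<beta> x)
     - 4 * \<i> * sqrt 3 * (complex_of_real (sqrt 21) - 3) * cnj (\<alpha> x) * cnj (\<beta> x)"
    using alpha_beta_cubic[OF root] by (simp add: ac_simps)
  have cubic': "\<alpha> x * (cnj (\<beta> x) * cnj (\<beta> x)) = - \<i> * sqrt 3 * cnj (\<alpha> x) * cnj (\<alpha> x) * \<beta> x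
     + 4 * \<i> * sqrt 3 * (complex_of_real (sqrt 21) - 3) * \<alpha> x * \<beta> x"
    using arg_cong[OF cubic, of cnj] by simp
  note vals = bicorr_values[OF q s i_squared norm_sum norm_prod cubic cubic']
  have scale: "K * (y :: complex) = z / 7" if "K * n = 1" "7 * y = z * n" for K y z n
  proof -
    have "7 * (K * y) = K * (7 * y)" by simp
    also have "\<dots> = z * (K * n)" unfolding that(2) by simp
    finally have "7 * (K * y) = z" using that(1) by simp
    then show ?thesis by (metis nonzero_mult_div_cancel_left zero_neq_numeral)
  qed
  have twice: "7 * y = 2 * ?N\<^sup>2 \<Longrightarrow> complex_of_real (\<theta>\<^sub>3 ^ 4) * y = 2 / 7"
    and once: "7 * y = ?N\<^sup>2 \<Longrightarrow> complex_of_real (\<theta>\<^sub>3 ^ 4) * y = 1 / 7" for y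
    using scale[OF N, of y 2] scale[OF N, of y 1] by simp_all
  have none: "y = 0 \<Longrightarrow> complex_of_real (\<theta>\<^sub>3 ^ 4) * y = 0" for y by simp
  note corr_values = vals(1)[THEN twice, folded corr_bicorr] vals(2-4)[THEN once, folded corr_bicorr]
    vals(5-)[THEN none, folded corr_bicorr]
  have sym: "?P c m \<Longrightarrow> ?P m c" for c m
    using corr_commute[of 6 "fiducial x" m c] fiducial_periodic by (simp add: add.commute)
  \<comment> \<open>The prescribed values are real, so the conjugation caused by a change of sign
    does not affect them.\<close>
  have neg: "?P c m" if "?P (- c) m" for c m
  proof -
    have "corr 6 (fiducial x) c m = cnj (corr 6 (fiducial x) (- c) m)"
      using corr_uminus[of 6 "fiducial x" "- c" m] fiducial_periodic by simp
    then show ?thesis unfolding that by simp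
  qed
  have red: "?P (c mod 6) (m mod 6) \<Longrightarrow> ?P c m" for c m
    using corr_mod[of 6 "fiducial x" c m] fiducial_periodic by (simp add: dvd_mod_iff)
  have small: "?P c m" if "c \<in> {0, 1, 2, 3}" "m \<in> {0, 1, 2, 3}" for c m
  proof -
    have le: "?P c m" if "c \<in> {0, 1, 2, 3}" "m \<in> {0, 1, 2, 3}" "c \<le> m" for c m
      using that by (auto simp: corr_values)
    show ?thesis
    proof (cases "c \<le> m")
      case True
      show ?thesis by (rule le[OF that True])
    next
      case False
      then have "m \<le> c" by simp
      show ?thesis by (rule sym[OF le[OF that(2,1) \<open>m \<le> c\<close>]])
    qed
  qed
  \<comment> \<open>The residues 4 and 5 are the negatives of 2 and 1.\<close>
  have half: "c mod 6 \<in> {0, 1, 2, 3} \<or> (- c) mod 6 \<in> {0, 1, 2, 3}" for c :: int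
  proof -
    have "c mod 6 \<in> {0, 1, 2, 3, 4, 5}"
      unfolding residues_6[symmetric] by simp
    then show ?thesis by (auto simp: zmod_zminus1_eq_if)
  qed
  have "?P c m" if "m \<in> {0, 1, 2, 3}" for c m
  proof -
    have "m mod 6 = m" using that by auto
    from half[of c] show ?thesis
    proof
      assume "c mod 6 \<in> {0, 1, 2, 3}"
      from red[OF small[OF this]] that \<open>m mod 6 = m\<close> show ?thesis by simp
    next
      assume "(- c) mod 6 \<in> {0, 1, 2, 3}"
      from neg[OF red[OF small[OF this]]] that \<open>m mod 6 = m\<close> show ?thesis by simp
    qed
  qed
  note left = this
  from half[of m] show ?thesis
  proof
    assume "m mod 6 \<in> {0, 1, 2, 3}"
    from red[OF left[OF this]] show ?thesis by simp
  next
    assume "(- m) mod 6 \<in> {0, 1, 2, 3}"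
    \<comment> \<open>The sign rule acts on the first argument only; conjugating it with the
      symmetry transfers it to \<open>m\<close>.\<close>
    from sym[OF neg[OF sym[OF red[OF left[OF this]]]]] show ?thesis .
  qed
qed

section \<open>The Heisenberg orbit\<close>

lemma omega_powi: "\<omega>\<^sub>6 powi n = cis (of_int n * (pi / 3))"
proof -
  have \<omega>: "\<omega>\<^sub>6 = cis (pi / 3)"
    unfolding \<omega>\<^sub>6_def cis_conv_exp by (rule arg_cong[of _ _ exp]) simp
  show ?thesis unfolding \<omega> by (rule cis_power_int)
qed

lemma norm_omega_powi: "norm (\<omega>\<^sub>6 powi n) = 1"
  by (simp add: omega_powi)

lemma norm_omega: "norm \<omega>\<^sub>6 = 1"
  using norm_omega_powi[of 1] by simp

lemma omega_nonzero: "\<omega>\<^sub>6 \<noteq> 0"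
  using norm_omega by force

lemma omega_powi_eq_1: "\<omega>\<^sub>6 powi n = 1 \<longleftrightarrow> 6 dvd n"
proof
  assume "6 dvd n"
  then obtain k where "n = 6 * k" ..
  then have "of_int n * (pi / 3) = 2 * pi * of_int k" by simp
  then show "\<omega>\<^sub>6 powi n = 1" by (simp only: omega_powi cis_multiple_2pi Ints_of_int)
next
  assume "\<omega>\<^sub>6 powi n = 1"
  then have "cos (of_int n * (pi / 3)) = 1" by (simp add: omega_powi complex_eq_iff)
  then obtain k :: int where "of_int n * (pi / 3) = of_int k * 2 * pi"
    by (auto simp: cos_one_2pi_int)
  then have "real_of_int n = real_of_int (6 * k)" by simp
  then show "6 dvd n" unfolding of_int_eq_iff by simp
qed

text \<open>The coordinates of X^a Z^b applied to the initial state, for arbitrary integers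
  \<open>a\<close> and \<open>b\<close>. On this index set the two generators act as plain shifts,
  up to a phase.\<close>

definition orbit :: "real \<Rightarrow> int \<Rightarrow> int \<Rightarrow> complex vec" where
  "orbit x a b = vec 6 (\<lambda>r. \<omega>\<^sub>6 powi (b * (int r - a)) * fiducial x (int r - a))"

lemma orbit_carrier: "orbit x a b \<in> carrier_vec 6"
  by (simp add: orbit_def)

lemma orbit_0_0: "orbit x 0 0 = \<phi>\<^sub>0 x"
  using \<phi>\<^sub>0_carrier[of x] by (intro eq_vecI) (auto simp: orbit_def \<phi>\<^sub>0_fiducial)

lemma orbit_periodic: "orbit x (a + 6) b = orbit x a b" "orbit x a (b + 6) = orbit x a b"
proof -
  have per: "fiducial x (k - (a + 6)) = fiducial x (k - a)" for k
    using fiducial_periodic[of x "k - (a + 6)"] by (simp add: algebra_simps)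
  have "\<omega>\<^sub>6 powi (b * 6) = 1" "\<omega>\<^sub>6 powi (6 * k) = 1" for k
    by (simp_all only: omega_powi_eq_1 dvd_triv_left dvd_triv_right)
  then show "orbit x (a + 6) b = orbit x a b" "orbit x a (b + 6) = orbit x a b"
    using omega_nonzero
    by (auto simp: orbit_def per power_int_add power_int_diff ring_distribs intro!: eq_vecI)
qed

lemma orbit_mod: "orbit x (a mod 6) (b mod 6) = orbit x a b"
  using periodic_mod[of "\<lambda>a. orbit x a (b mod 6)" 6 a] periodic_mod[of "orbit x a" 6 b]
  by (simp add: orbit_periodic)

lemma X\<^sub>6_carrier: "X\<^sub>6 \<in> carrier_mat 6 6" and Z\<^sub>6_carrier: "Z\<^sub>6 \<in> carrier_mat 6 6"
  by (simp_all add: X\<^sub>6_def Z\<^sub>6_def)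

lemma X\<^sub>6_mult_vec:
  assumes "v \<in> carrier_vec 6"
  shows "X\<^sub>6 *\<^sub>v v = vec 6 (\<lambda>r. v $ nat ((int r - 1) mod 6))"
proof (rule eq_vecI)
  fix r assume "r < dim_vec (vec 6 (\<lambda>r. v $ nat ((int r - 1) mod 6)))"
  then have r: "r < 6" by simp
  have shift: "r = (c + 1) mod 6 \<longleftrightarrow> c = nat ((int r - 1) mod 6)" if "c < 6" for c
  proof -
    have "(c + 1) mod 6 = (if c = 5 then 0 else c + 1)" using that by simp
    moreover have "nat ((int r - 1) mod 6) = (if r = 0 then 5 else r - 1)"
      using r by (cases r) simp_all
    ultimately show ?thesis using that r by auto
  qed
  have "(X\<^sub>6 *\<^sub>v v) $ r = (\<Sum>c\<in>{0..<6}. (if r = (c + 1) mod 6 then 1 else 0) * v $ c)"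
    using r assms by (simp add: X\<^sub>6_def scalar_prod_def)
  also have "\<dots> = (\<Sum>c\<in>{0..<6}. if c = nat ((int r - 1) mod 6) then v $ c else 0)"
  proof (rule sum.cong[OF refl])
    fix c :: nat assume "c \<in> {0..<6}"
    then have "c < 6" by simp
    show "(if r = (c + 1) mod 6 then 1 else 0) * v $ c
      = (if c = nat ((int r - 1) mod 6) then v $ c else 0)"
      unfolding shift[OF \<open>c < 6\<close>] by simp
  qed
  also have "\<dots> = v $ nat ((int r - 1) mod 6)"
    by (simp add: nat_less_iff)
  finally show "(X\<^sub>6 *\<^sub>v v) $ r = vec 6 (\<lambda>r. v $ nat ((int r - 1) mod 6)) $ r"
    using r by simp
qed (simp add: X\<^sub>6_def)

lemma Z\<^sub>6_mult_vec:
  assumes "v \<in> carrier_vec 6"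
  shows "Z\<^sub>6 *\<^sub>v v = vec 6 (\<lambda>r. \<omega>\<^sub>6 ^ r * v $ r)"
proof (rule eq_vecI)
  fix r assume "r < dim_vec (vec 6 (\<lambda>r. \<omega>\<^sub>6 ^ r * v $ r))"
  then have r: "r < 6" by simp
  have "(Z\<^sub>6 *\<^sub>v v) $ r = (\<Sum>c\<in>{0..<6}. (if r = c then \<omega>\<^sub>6 ^ c else 0) * v $ c)"
    using r assms by (simp add: Z\<^sub>6_def scalar_prod_def)
  also have "\<dots> = (\<Sum>c\<in>{0..<6}. if c = r then \<omega>\<^sub>6 ^ c * v $ c else 0)"
    by (rule sum.cong) auto
  finally show "(Z\<^sub>6 *\<^sub>v v) $ r = vec 6 (\<lambda>r. \<omega>\<^sub>6 ^ r * v $ r) $ r"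
    using r by simp
qed (simp add: Z\<^sub>6_def)

lemma X\<^sub>6_orbit: "X\<^sub>6 *\<^sub>v orbit x a b = orbit x (a + 1) b"
proof -
  \<comment> \<open>As a function of an integer row index the entry has period 6, which absorbs the
    \<open>mod 6\<close> in the action of \<open>X\<^sub>6\<close>.\<close>
  define h where "h k = \<omega>\<^sub>6 powi (b * (k - a)) * fiducial x (k - a)" for k
  have "fiducial x (k + 6 - a) = fiducial x (k - a)" for k
    using fiducial_periodic[of x "k - a"] by (simp add: algebra_simps)
  moreover have "\<omega>\<^sub>6 powi (b * 6) = 1" by (simp only: omega_powi_eq_1 dvd_triv_right)
  ultimately have "h (k + 6) = h k" for k
    using omega_nonzero by (simp add: h_def power_int_add power_int_diff ring_distribs)
  then have "h (k mod 6) = h k" for k by (rule periodic_mod)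
  then show ?thesis
    unfolding X\<^sub>6_mult_vec[OF orbit_carrier]
    by (auto simp: orbit_def nat_less_iff h_def algebra_simps intro!: eq_vecI)
qed

text \<open>The phase arises from splitting the exponent \<open>r\<close> as
  \<open>a + (r - a)\<close>.\<close>

lemma Z\<^sub>6_orbit: "Z\<^sub>6 *\<^sub>v orbit x a b = \<omega>\<^sub>6 powi a \<cdot>\<^sub>v orbit x a (b + 1)"
proof -
  have "\<omega>\<^sub>6 ^ r * \<omega>\<^sub>6 powi (b * (int r - a)) = \<omega>\<^sub>6 powi a * \<omega>\<^sub>6 powi ((b + 1) * (int r - a))" for r
  proof -
    have "\<omega>\<^sub>6 powi int r * \<omega>\<^sub>6 powi (b * (int r - a)) = \<omega>\<^sub>6 powi (a + (b + 1) * (int r - a))"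
      using omega_nonzero by (subst power_int_add[symmetric]) (simp_all add: algebra_simps)
    then show ?thesis using omega_nonzero by (simp add: power_int_add)
  qed
  then show ?thesis
    unfolding Z\<^sub>6_mult_vec[OF orbit_carrier]
    by (auto simp: orbit_def simp flip: mult.assoc intro!: eq_vecI)
qed

lemma mult_X\<^sub>6:
  assumes "A \<in> carrier_mat 6 6" "r < 6" "c < 6"
  shows "(A * X\<^sub>6) $$ (r, c) = A $$ (r, (c + 1) mod 6)"
proof -
  have "(A * X\<^sub>6) $$ (r, c) = (\<Sum>k\<in>{0..<6}. A $$ (r, k) * (if k = (c + 1) mod 6 then 1 else 0))"
    using assms by (simp add: X\<^sub>6_def scalar_prod_def)
  also have "\<dots> = (\<Sum>k\<in>{0..<6}. if k = (c + 1) mod 6 then A $$ (r, k) else 0)"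
    by (rule sum.cong) auto
  finally show ?thesis by simp
qed

lemma mult_Z\<^sub>6:
  assumes "A \<in> carrier_mat 6 6" "r < 6" "c < 6"
  shows "(A * Z\<^sub>6) $$ (r, c) = A $$ (r, c) * \<omega>\<^sub>6 ^ c"
proof -
  have "(A * Z\<^sub>6) $$ (r, c) = (\<Sum>k\<in>{0..<6}. A $$ (r, k) * (if k = c then \<omega>\<^sub>6 ^ c else 0))"
    using assms by (simp add: Z\<^sub>6_def scalar_prod_def)
  also have "\<dots> = (\<Sum>k\<in>{0..<6}. if k = c then A $$ (r, k) * \<omega>\<^sub>6 ^ c else 0)"
    by (rule sum.cong) auto
  finally show ?thesis using assms(3) by simp
qed

lemma X\<^sub>6_pow: "X\<^sub>6 ^\<^sub>m n = mat 6 6 (\<lambda>(r, c). if r = (c + n) mod 6 then 1 else 0)"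
proof (induction n)
  case 0
  show ?case by (intro eq_matI) (auto simp: X\<^sub>6_def)
next
  case (Suc n)
  show ?case
  proof (rule eq_matI)
    fix r c assume "r < dim_row (mat 6 6 (\<lambda>(r, c). if r = (c + Suc n) mod 6 then 1 else 0 :: complex))"
      and "c < dim_col (mat 6 6 (\<lambda>(r, c). if r = (c + Suc n) mod 6 then 1 else 0 :: complex))"
    then have rc: "r < 6" "c < 6" by simp_all
    have "((c + 1) mod 6 + n) mod 6 = (c + Suc n) mod 6" by (simp add: mod_simps)
    with rc show "(X\<^sub>6 ^\<^sub>m Suc n) $$ (r, c) = mat 6 6 (\<lambda>(r, c). if r = (c + Suc n) mod 6 then 1 else 0) $$ (r, c)"
      unfolding pow_mat.simps mult_X\<^sub>6[OF pow_carrier_mat[OF X\<^sub>6_carrier] rc]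
      unfolding Suc.IH by simp
  qed (use X\<^sub>6_carrier in auto)
qed

lemma Z\<^sub>6_pow: "Z\<^sub>6 ^\<^sub>m n = mat 6 6 (\<lambda>(r, c). if r = c then \<omega>\<^sub>6 ^ (c * n) else 0)"
proof (induction n)
  case 0
  show ?case by (intro eq_matI) (auto simp: Z\<^sub>6_def)
next
  case (Suc n)
  show ?case
  proof (rule eq_matI)
    fix r c assume "r < dim_row (mat 6 6 (\<lambda>(r, c). if r = c then \<omega>\<^sub>6 ^ (c * Suc n) else 0))"
      and "c < dim_col (mat 6 6 (\<lambda>(r, c). if r = c then \<omega>\<^sub>6 ^ (c * Suc n) else 0))"
    then have rc: "r < 6" "c < 6" by simp_all
    then show "(Z\<^sub>6 ^\<^sub>m Suc n) $$ (r, c) = mat 6 6 (\<lambda>(r, c). if r = c then \<omega>\<^sub>6 ^ (c * Suc n) else 0) $$ (r, c)"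
      unfolding pow_mat.simps mult_Z\<^sub>6[OF pow_carrier_mat[OF Z\<^sub>6_carrier] rc]
      unfolding Suc.IH by (simp add: power_add)
  qed (use Z\<^sub>6_carrier in auto)
qed

text \<open>The finite order of the generators later expresses their inverses as powers.\<close>

lemma X\<^sub>6_pow_6: "X\<^sub>6 ^\<^sub>m 6 = 1\<^sub>m 6"
  unfolding X\<^sub>6_pow by (intro eq_matI) auto

lemma Z\<^sub>6_pow_6: "Z\<^sub>6 ^\<^sub>m 6 = 1\<^sub>m 6"
proof -
  have "\<omega>\<^sub>6 ^ (c * 6) = 1" for c
    using omega_powi_eq_1[of "int (c * 6)"] by (simp only: power_int_of_nat) simp
  then show ?thesis
    unfolding Z\<^sub>6_pow by (intro eq_matI) auto
qed

lemma XZ_orbit: "(X\<^sub>6 ^\<^sub>m a * Z\<^sub>6 ^\<^sub>m b) *\<^sub>v \<phi>\<^sub>0 x = orbit x (int a) (int b)"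
proof -
  \<comment> \<open>The start \<open>c\<close> is arbitrary because \<open>pow_mat\<close> puts the
    new factor on the right, where it acts first. At position 0 the phase of
    \<open>Z\<^sub>6_orbit\<close> is 1.\<close>
  have Z: "Z\<^sub>6 ^\<^sub>m b *\<^sub>v orbit x 0 c = orbit x 0 (c + int b)" for c
  proof (induction b arbitrary: c)
    case 0
    then show ?case using orbit_carrier[of x 0 c] Z\<^sub>6_carrier by simp
  next
    case (Suc b)
    have "Z\<^sub>6 ^\<^sub>m Suc b *\<^sub>v orbit x 0 c = Z\<^sub>6 ^\<^sub>m b *\<^sub>v (Z\<^sub>6 *\<^sub>v orbit x 0 c)"
      using Z\<^sub>6_carrier orbit_carrier by (simp add: assoc_mult_mat_vec[of _ 6 6 _ 6] pow_carrier_mat)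
    then show ?case by (simp add: Z\<^sub>6_orbit Suc.IH ac_simps)
  qed
  have X: "X\<^sub>6 ^\<^sub>m a *\<^sub>v orbit x c d = orbit x (c + int a) d" for c d
  proof (induction a arbitrary: c)
    case 0
    then show ?case using orbit_carrier[of x c d] X\<^sub>6_carrier by simp
  next
    case (Suc a)
    have "X\<^sub>6 ^\<^sub>m Suc a *\<^sub>v orbit x c d = X\<^sub>6 ^\<^sub>m a *\<^sub>v (X\<^sub>6 *\<^sub>v orbit x c d)"
      using X\<^sub>6_carrier orbit_carrier by (simp add: assoc_mult_mat_vec[of _ 6 6 _ 6] pow_carrier_mat)
    then show ?case by (simp add: X\<^sub>6_orbit Suc.IH ac_simps)
  qed
  have "(X\<^sub>6 ^\<^sub>m a * Z\<^sub>6 ^\<^sub>m b) *\<^sub>v \<phi>\<^sub>0 x = X\<^sub>6 ^\<^sub>m a *\<^sub>v (Z\<^sub>6 ^\<^sub>m b *\<^sub>v orbit x 0 0)"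
    unfolding orbit_0_0
    by (rule assoc_mult_mat_vec[of _ 6 6 _ 6])
      (simp_all add: X\<^sub>6_carrier Z\<^sub>6_carrier pow_carrier_mat \<phi>\<^sub>0_carrier)
  then show ?thesis by (simp add: X Z)
qed

text \<open>The two phases combine to \<open>\<omega>\<^sub>6 powi ((b' - b) * k)\<close> times a
  factor independent of \<open>k\<close>, which the modulus removes; the remaining sum is the one in
  \<open>overlap_if_corr\<close>.\<close>

lemma orbit_overlap:
  assumes "poly poly_f x = 0"
  shows "(cmod (braket (orbit x a b) (orbit x a' b')))\<^sup>2
    = (if 6 dvd a' - a \<and> 6 dvd b' - b then 1 else 1 / 7)"
proof -
  have eq: "\<omega>\<^sub>6 powi (b' * (k - a')) * cnj (\<omega>\<^sub>6 powi (b * (k - a)))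
    = \<omega>\<^sub>6 powi (a * b - a' * b') * \<omega>\<^sub>6 powi ((b' - b) * k)" for k
  proof -
    have "cnj (\<omega>\<^sub>6 powi n) = \<omega>\<^sub>6 powi (- n)" for n
      by (simp add: omega_powi cis_cnj)
    then show ?thesis
      using omega_nonzero by (simp add: power_int_add[symmetric] algebra_simps)
  qed
  have phase: "\<omega>\<^sub>6 powi (b' * (k - a')) * y * (cnj (\<omega>\<^sub>6 powi (b * (k - a))) * z)
    = \<omega>\<^sub>6 powi (a * b - a' * b') * (\<omega>\<^sub>6 powi ((b' - b) * k) * y * z)" for k y z
  proof -
    have "\<omega>\<^sub>6 powi (b' * (k - a')) * y * (cnj (\<omega>\<^sub>6 powi (b * (k - a))) * z)
      = \<omega>\<^sub>6 powi (b' * (k - a')) * cnj (\<omega>\<^sub>6 powi (b * (k - a))) * (y * z)"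
      by (simp only: ac_simps)
    then show ?thesis unfolding eq by (simp only: ac_simps)
  qed
  have "braket (orbit x a b) (orbit x a' b') = (\<Sum>r\<in>{0..<6}.
      \<omega>\<^sub>6 powi (b' * (int r - a')) * fiducial x (int r - a') *
      (cnj (\<omega>\<^sub>6 powi (b * (int r - a))) * cnj (fiducial x (int r - a))))"
    by (simp add: braket_def orbit_def scalar_prod_def conjugate_complex_def)
  also have "\<dots> = (\<Sum>k\<in>{0..<6}.
      \<omega>\<^sub>6 powi (b' * (k - a')) * fiducial x (k - a') *
      (cnj (\<omega>\<^sub>6 powi (b * (k - a))) * cnj (fiducial x (k - a))))"
    by (rule sum.reindex_bij_witness[of _ nat int]) auto
  also have "\<dots> = \<omega>\<^sub>6 powi (a * b - a' * b') * (\<Sum>k\<in>{0..<6}.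
      \<omega>\<^sub>6 powi ((b' - b) * k) * fiducial x (k - a') * cnj (fiducial x (k - a)))"
    unfolding phase sum_distrib_left ..
  finally have "cmod (braket (orbit x a b) (orbit x a' b')) = cmod (\<Sum>k\<in>{0..<6}.
      \<omega>\<^sub>6 powi ((b' - b) * k) * fiducial x (k - a') * cnj (fiducial x (k - a)))"
    by (simp add: norm_mult norm_omega_powi)
  moreover have "\<omega>\<^sub>6 powi 6 = 1" unfolding omega_powi_eq_1 by simp
  ultimately show ?thesis
    using overlap_if_corr[of 6 "fiducial x" \<omega>\<^sub>6 "b' - b" a' a,
        OF _ fiducial_periodic _ norm_omega corr_fiducial[OF assms]]
    by (simp add: omega_powi_eq_1)
qed

text \<open>The overlap formula for equal indices gives modulus 1, and the inner product of a vector
  with itself is real and nonnegative.\<close>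

lemma orbit_norm:
  assumes "poly poly_f x = 0"
  shows "braket (orbit x a b) (orbit x a b) = 1"
proof -
  have "braket (orbit x a b) (orbit x a b) \<ge> 0"
    unfolding braket_def by (rule conjugate_square_ge_0_vec)
  moreover have "(cmod (braket (orbit x a b) (orbit x a b)))\<^sup>2 = 1"
    using orbit_overlap[OF assms, of a b a b] by simp
  then have "cmod (braket (orbit x a b) (orbit x a b)) = 1"
    by (simp add: power2_eq_1_iff) (metis norm_ge_zero not_one_le_zero neg_0_le_iff_le)
  ultimately show ?thesis
    by (metis complex_is_Real_iff less_eq_complex_def norm_of_real of_real_1 of_real_Re abs_of_nonneg zero_complex.sel)
qed

section \<open>Invariance\<close>

lemma mat_adjoint_index:
  fixes A :: "complex mat"
  assumes "i < dim_col A" "j < dim_row A"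
  shows "mat_adjoint A $$ (i, j) = cnj (A $$ (j, i))"
  using assms by (simp add: mat_adjoint_def mat_of_rows_def conjugate_complex_def)

lemma mat_adjoint_carrier: "A \<in> carrier_mat n m \<Longrightarrow> mat_adjoint A \<in> carrier_mat m n"
  by (auto simp: mat_adjoint_def mat_of_rows_def)

lemma mat_adjoint_mult:
  fixes A B :: "complex mat"
  assumes "A \<in> carrier_mat n m" "B \<in> carrier_mat m k"
  shows "mat_adjoint (A * B) = mat_adjoint B * mat_adjoint A"
  using assms mat_adjoint_carrier[OF assms(1)] mat_adjoint_carrier[OF assms(2)]
    mat_adjoint_carrier[OF mult_carrier_mat[OF assms]]
  by (intro eq_matI)
    (auto simp: mat_adjoint_index scalar_prod_def mult.commute intro!: sum.cong)

lemma braket_adjoint: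
  assumes "A \<in> carrier_mat n m" "u \<in> carrier_vec m" "v \<in> carrier_vec n"
  shows "braket u (mat_adjoint A *\<^sub>v v) = braket (A *\<^sub>v u) v"
proof -
  note A' = mat_adjoint_carrier[OF assms(1)]
  have "braket u (mat_adjoint A *\<^sub>v v) = (\<Sum>i\<in>{0..<m}. \<Sum>j\<in>{0..<n}. cnj (A $$ (j, i)) * v $ j * cnj (u $ i))"
    using assms A' by (auto simp: braket_def scalar_prod_def mat_adjoint_index conjugate_complex_def
        sum_distrib_right intro!: sum.cong)
  also have "\<dots> = (\<Sum>j\<in>{0..<n}. \<Sum>i\<in>{0..<m}. cnj (A $$ (j, i)) * v $ j * cnj (u $ i))"
    by (rule sum.swap)
  also have "\<dots> = braket (A *\<^sub>v u) v"
    using assms by (auto simp: braket_def scalar_prod_def conjugate_complex_def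
        sum_distrib_left ac_simps intro!: sum.cong)
  finally show ?thesis .
qed

lemma ketbra_conj:
  assumes "A \<in> carrier_mat n n" "u \<in> carrier_vec n"
  shows "A * ketbra u u * mat_adjoint A = ketbra (A *\<^sub>v u) (A *\<^sub>v u)"
proof (rule eq_matI)
  note A' = mat_adjoint_carrier[OF assms(1)]
  fix i j assume "i < dim_row (ketbra (A *\<^sub>v u) (A *\<^sub>v u))" "j < dim_col (ketbra (A *\<^sub>v u) (A *\<^sub>v u))"
  then have ij: "i < n" "j < n" using assms by (auto simp: ketbra_def)
  have "(A * ketbra u u * mat_adjoint A) $$ (i, j)
    = (\<Sum>k\<in>{0..<n}. (\<Sum>l\<in>{0..<n}. A $$ (i, l) * (u $ l * cnj (u $ k))) * cnj (A $$ (j, k)))"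
    using ij assms A' by (auto simp: scalar_prod_def ketbra_def mat_adjoint_index intro!: sum.cong)
  also have "\<dots> = (\<Sum>k\<in>{0..<n}. (\<Sum>l\<in>{0..<n}. A $$ (i, l) * u $ l) * (cnj (A $$ (j, k)) * cnj (u $ k)))"
    by (intro sum.cong refl) (simp add: sum_distrib_left sum_distrib_right ac_simps)
  also have "\<dots> = (\<Sum>l\<in>{0..<n}. A $$ (i, l) * u $ l) * cnj (\<Sum>k\<in>{0..<n}. A $$ (j, k) * u $ k)"
    by (simp add: sum_distrib_left)
  also have "\<dots> = ketbra (A *\<^sub>v u) (A *\<^sub>v u) $$ (i, j)"
    using ij assms by (simp add: ketbra_def scalar_prod_def)
  finally show "(A * ketbra u u * mat_adjoint A) $$ (i, j) = ketbra (A *\<^sub>v u) (A *\<^sub>v u) $$ (i, j)" .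
qed (use assms mat_adjoint_carrier[OF assms(1)] in \<open>auto simp: ketbra_def\<close>)

lemma povm_element_conj:
  assumes "A \<in> carrier_mat n n" "u \<in> carrier_vec n"
  shows "A * povm_element d u * mat_adjoint A = povm_element d (A *\<^sub>v u)"
proof -
  note A' = mat_adjoint_carrier[OF assms(1)]
  have k: "ketbra u u \<in> carrier_mat n n" using assms by (auto simp: ketbra_def)
  show ?thesis
    unfolding povm_element_def ketbra_conj[OF assms, symmetric]
      mult_smult_distrib[OF assms(1) k] mult_smult_assoc_mat[OF mult_carrier_mat[OF assms(1) k] A'] ..
qed

lemma povm_element_phase:
  assumes "norm c = 1"
  shows "povm_element d (c \<cdot>\<^sub>v u) = povm_element d u"
proof -
  have "c * cnj c = 1" using assms complex_norm_square[of c] by simp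
  then have "c * y * (cnj c * z) = y * z" for y z
    by (metis mult.left_commute mult.commute mult_1)
  then show ?thesis
    unfolding povm_element_def by (intro arg_cong2[of _ _ _ _ "(\<cdot>\<^sub>m)"] eq_matI) (auto simp: ketbra_def)
qed

text \<open>Indexing the same operators by all pairs of integers avoids wrap-around: the shifts
  induced by the generators are bijections of the index set.\<close>

lemma orbit_povm_image:
  "(\<lambda>(a, b). povm_element 6 ((X\<^sub>6 ^\<^sub>m a * Z\<^sub>6 ^\<^sub>m b) *\<^sub>v \<phi>\<^sub>0 x)) ` ({0..5} \<times> {0..5})
   = range (\<lambda>(a, b). povm_element 6 (orbit x a b))" (is "?l = ?r")
proof
  show "?l \<subseteq> ?r" by (auto simp: XZ_orbit)
  show "?r \<subseteq> ?l"
  proof (rule image_subsetI, clarify)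
    fix a b :: int
    have "nat (a mod 6) \<in> {0..5}" "nat (b mod 6) \<in> {0..5}"
      using pos_mod_bound[of 6 a] pos_mod_bound[of 6 b] by (auto simp: nat_le_iff)
    moreover have "povm_element 6 ((X\<^sub>6 ^\<^sub>m nat (a mod 6) * Z\<^sub>6 ^\<^sub>m nat (b mod 6)) *\<^sub>v \<phi>\<^sub>0 x)
      = povm_element 6 (orbit x a b)"
      by (simp add: XZ_orbit orbit_mod)
    ultimately show "povm_element 6 (orbit x a b) \<in> ?l"
      by (intro image_eqI[of _ _ "(nat (a mod 6), nat (b mod 6))"]) auto
  qed
qed

definition stabilizes :: "complex mat \<Rightarrow> complex mat set \<Rightarrow> bool" where
  "stabilizes g S \<longleftrightarrow> g \<in> carrier_mat 6 6 \<and> (\<lambda>A. g * A * mat_adjoint g) ` S = S"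

lemma stabilizes_mult:
  assumes "stabilizes g S" "stabilizes h S" "S \<subseteq> carrier_mat 6 6"
  shows "stabilizes (g * h) S"
proof -
  have g: "g \<in> carrier_mat 6 6" and h: "h \<in> carrier_mat 6 6"
    using assms by (auto simp: stabilizes_def)
  have "g * h * A * mat_adjoint (g * h) = g * (h * A * mat_adjoint h) * mat_adjoint g"
    if "A \<in> S" for A
  proof -
    have "A \<in> carrier_mat 6 6" using that assms(3) by auto
    then show ?thesis
      using g h mat_adjoint_carrier[OF g] mat_adjoint_carrier[OF h]
      by (simp add: mat_adjoint_mult[OF g h] assoc_mult_mat[of _ 6 6 _ 6 _ 6])
  qed
  then have "(\<lambda>A. g * h * A * mat_adjoint (g * h)) ` S
    = (\<lambda>A. g * A * mat_adjoint g) ` (\<lambda>A. h * A * mat_adjoint h) ` S"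
    unfolding image_image by (rule image_cong[OF refl])
  with assms g h show ?thesis unfolding stabilizes_def by simp
qed

lemma stabilizes_one:
  assumes "S \<subseteq> carrier_mat 6 6"
  shows "stabilizes (1\<^sub>m 6) S"
proof -
  have "mat_adjoint (1\<^sub>m 6 :: complex mat) = 1\<^sub>m 6"
    using mat_adjoint_carrier[of "1\<^sub>m 6 :: complex mat" 6 6]
    by (intro eq_matI) (auto simp: mat_adjoint_index)
  then have "1\<^sub>m 6 * A * mat_adjoint (1\<^sub>m 6) = A" if "A \<in> S" for A
    using that assms by (simp add: subset_iff left_mult_one_mat[of _ 6 6] right_mult_one_mat[of _ 6 6])
  then show ?thesis by (simp add: stabilizes_def)
qed

lemma stabilizes_pow:
  assumes "stabilizes g S" "S \<subseteq> carrier_mat 6 6"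
  shows "stabilizes (g ^\<^sub>m n) S"
proof (induction n)
  case 0
  have "dim_row g = 6" using assms(1) by (auto simp: stabilizes_def)
  then show ?case using stabilizes_one[OF assms(2)] by simp
next
  case (Suc n)
  then show ?case using assms by (simp add: stabilizes_mult)
qed

text \<open>Since \<open>h ^\<^sub>m n\<close> is the identity, the inverse of a generator in the
  group of units is the power with exponent \<open>n - 1\<close>, and the inverse case reduces to
  \<open>stabilizes_pow\<close>.\<close>

lemma generate_units_stabilizes:
  assumes S: "S \<subseteq> carrier_mat 6 6"
    and n: "n > 0"
    and stab: "\<And>h. h \<in> H \<Longrightarrow> stabilizes h S"
    and pow: "\<And>h. h \<in> H \<Longrightarrow> h ^\<^sub>m n = 1\<^sub>m 6"
    and g: "g \<in> generate (units_of (ring_mat TYPE(complex) 6 ())) H"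
  shows "stabilizes g S"
proof -
  let ?R = "ring_mat TYPE(complex) 6 ()"
  interpret R: ring ?R by (rule ring_mat)
  interpret U: group "units_of ?R" by (rule R.units_group)
  note U_simps = units_of_mult units_of_one units_of_carrier ring_mat_simps
  from g show ?thesis
  proof induction
    case one
    then show ?case using stabilizes_one[OF S] by (simp add: U_simps)
  next
    case (incl h)
    then show ?case by (rule stab)
  next
    case (inv h)
    obtain k where k: "n = Suc k" using n by (cases n) auto
    have h: "h \<in> carrier_mat 6 6" using stab[OF inv] by (simp add: stabilizes_def)
    have hn: "h ^\<^sub>m k \<in> carrier_mat 6 6" using h by (rule pow_carrier_mat)
    have l: "h ^\<^sub>m k * h = 1\<^sub>m 6" using pow[OF inv] by (simp add: k)
    have r: "h * h ^\<^sub>m k = 1\<^sub>m 6"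
      by (rule mat_mult_left_right_inverse[OF hn h l])
    have "h \<in> Units ?R" "h ^\<^sub>m k \<in> Units ?R"
      using h hn l r by (auto simp: Units_def ring_mat_simps)
    then have "inv\<^bsub>units_of ?R\<^esub> h = h ^\<^sub>m k"
      using l by (intro U.inv_equality) (simp_all add: U_simps)
    then show ?case using stabilizes_pow[OF stab[OF inv] S] by simp
  next
    case (eng h1 h2)
    then show ?case using stabilizes_mult[OF _ _ S] by (simp add: U_simps)
  qed
qed

lemma heisenberg_stabilizes_orbit:
  assumes "g \<in> heisenberg_group"
  shows "stabilizes g (range (\<lambda>(a, b). povm_element 6 (orbit x a b)))"
proof -
  let ?S = "range (\<lambda>(a, b). povm_element 6 (orbit x a b))"
  \<comment> \<open>Surjectivity of the index shifts turns the inclusion of the image in the set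
    into the equality that \<open>stabilizes\<close> demands.\<close>
  have shift: "surj (\<lambda>(a, b). (a + 1, b) :: int \<times> int)" "surj (\<lambda>(a, b). (a, b + 1) :: int \<times> int)"
    by (rule surjI[of _ "\<lambda>(a, b). (a - 1, b)"], force) (rule surjI[of _ "\<lambda>(a, b). (a, b - 1)"], force)
  have "(\<lambda>A. X\<^sub>6 * A * mat_adjoint X\<^sub>6) ` ?S
    = (\<lambda>(a, b). povm_element 6 (orbit x a b)) ` range (\<lambda>(a, b). (a + 1, b))"
    unfolding image_image
    by (intro image_cong) (auto simp: povm_element_conj[OF X\<^sub>6_carrier orbit_carrier] X\<^sub>6_orbit)
  then have X: "stabilizes X\<^sub>6 ?S"
    by (simp add: stabilizes_def X\<^sub>6_carrier shift)
  have "(\<lambda>A. Z\<^sub>6 * A * mat_adjoint Z\<^sub>6) ` ?S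
    = (\<lambda>(a, b). povm_element 6 (orbit x a b)) ` range (\<lambda>(a, b). (a, b + 1))"
    unfolding image_image
    by (intro image_cong) (auto simp: povm_element_conj[OF Z\<^sub>6_carrier orbit_carrier] Z\<^sub>6_orbit
        povm_element_phase norm_omega_powi)
  then have Z: "stabilizes Z\<^sub>6 ?S"
    by (simp add: stabilizes_def Z\<^sub>6_carrier shift)
  have S: "?S \<subseteq> carrier_mat 6 6"
    by (auto simp: povm_element_def ketbra_def orbit_def)
  show ?thesis
    using X Z X\<^sub>6_pow_6 Z\<^sub>6_pow_6
    by (intro generate_units_stabilizes[OF S _ _ _ assms[unfolded heisenberg_group_def], of 6]) auto
qed

theorem mainTheorem1:
  fixes \<theta>\<^sub>2 :: real
  assumes "poly poly_f \<theta>\<^sub>2 = 0"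
  shows "braket (\<phi>\<^sub>0 \<theta>\<^sub>2) (\<phi>\<^sub>0 \<theta>\<^sub>2) = 1
    \<and> is_sic_povm 6 ({0..5::nat} \<times> {0..5::nat})
        (\<lambda>(a, b). povm_element 6 ((X\<^sub>6 ^\<^sub>m a * Z\<^sub>6 ^\<^sub>m b) *\<^sub>v \<phi>\<^sub>0 \<theta>\<^sub>2))
    \<and> invariant_under heisenberg_group ({0..5::nat} \<times> {0..5::nat})
        (\<lambda>(a, b). povm_element 6 ((X\<^sub>6 ^\<^sub>m a * Z\<^sub>6 ^\<^sub>m b) *\<^sub>v \<phi>\<^sub>0 \<theta>\<^sub>2))
    \<and> (\<forall>a\<in>{0..5::nat}. \<forall>b\<in>{0..5::nat}. \<forall>a'\<in>{0..5::nat}. \<forall>b'\<in>{0..5::nat}.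
         (a, b) \<noteq> (a', b') \<longrightarrow>
         (cmod (braket (\<phi>\<^sub>0 \<theta>\<^sub>2)
            ((mat_adjoint (X\<^sub>6 ^\<^sub>m a * Z\<^sub>6 ^\<^sub>m b) * (X\<^sub>6 ^\<^sub>m a' * Z\<^sub>6 ^\<^sub>m b')) *\<^sub>v \<phi>\<^sub>0 \<theta>\<^sub>2)))\<^sup>2 = 1 / 7)"
proof (intro conjI)
  have XZ: "X\<^sub>6 ^\<^sub>m a * Z\<^sub>6 ^\<^sub>m b \<in> carrier_mat 6 6" for a b
    by (intro mult_carrier_mat[of _ 6 6] pow_carrier_mat X\<^sub>6_carrier Z\<^sub>6_carrier)
  have overlap: "(cmod (braket (orbit \<theta>\<^sub>2 (int a) (int b)) (orbit \<theta>\<^sub>2 (int a') (int b'))))\<^sup>2 = 1 / 7"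
    if "a \<in> {0..5}" "b \<in> {0..5}" "a' \<in> {0..5}" "b' \<in> {0..5}" "(a, b) \<noteq> (a', b')" for a b a' b'
  proof -
    \<comment> \<open>Two indices between 0 and 5 that are congruent modulo 6 coincide.\<close>
    have "m = n" if "6 dvd int m - int n" "m \<in> {0..5}" "n \<in> {0..5}" for m n
      using that zdvd_imp_le[of 6 "int m - int n"] zdvd_imp_le[of 6 "int n - int m"]
      by (cases m n rule: linorder_cases) (auto simp: dvd_diff_commute)
    with that have "\<not> (6 dvd int a' - int a \<and> 6 dvd int b' - int b)" by blast
    then show ?thesis unfolding orbit_overlap[OF assms] by simp
  qed
  show "braket (\<phi>\<^sub>0 \<theta>\<^sub>2) (\<phi>\<^sub>0 \<theta>\<^sub>2) = 1"
    using orbit_norm[OF assms, of 0 0] by (simp add: orbit_0_0)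
  show "is_sic_povm 6 ({0..5::nat} \<times> {0..5::nat})
        (\<lambda>(a, b). povm_element 6 ((X\<^sub>6 ^\<^sub>m a * Z\<^sub>6 ^\<^sub>m b) *\<^sub>v \<phi>\<^sub>0 \<theta>\<^sub>2))"
    unfolding is_sic_povm_def XZ_orbit
  proof (intro conjI exI[of _ "\<lambda>(a, b). orbit \<theta>\<^sub>2 (int a) (int b)"] ballI impI)
    fix j k :: "nat \<times> nat"
    assume "j \<in> {0..5} \<times> {0..5}" "k \<in> {0..5} \<times> {0..5}" "j \<noteq> k"
    then show "(cmod (braket (case j of (a, b) \<Rightarrow> orbit \<theta>\<^sub>2 (int a) (int b))
        (case k of (a, b) \<Rightarrow> orbit \<theta>\<^sub>2 (int a) (int b))))\<^sup>2 = 1 / (real 6 + 1)"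
      using overlap[of "fst j" "snd j" "fst k" "snd k"] by (auto simp: case_prod_beta)
  qed (auto simp: orbit_carrier orbit_norm[OF assms])
  show "invariant_under heisenberg_group ({0..5::nat} \<times> {0..5::nat})
        (\<lambda>(a, b). povm_element 6 ((X\<^sub>6 ^\<^sub>m a * Z\<^sub>6 ^\<^sub>m b) *\<^sub>v \<phi>\<^sub>0 \<theta>\<^sub>2))"
    using heisenberg_stabilizes_orbit
    unfolding invariant_under_def orbit_povm_image stabilizes_def by blast
  show "\<forall>a\<in>{0..5::nat}. \<forall>b\<in>{0..5::nat}. \<forall>a'\<in>{0..5::nat}. \<forall>b'\<in>{0..5::nat}.
         (a, b) \<noteq> (a', b') \<longrightarrow>
         (cmod (braket (\<phi>\<^sub>0 \<theta>\<^sub>2)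
            ((mat_adjoint (X\<^sub>6 ^\<^sub>m a * Z\<^sub>6 ^\<^sub>m b) * (X\<^sub>6 ^\<^sub>m a' * Z\<^sub>6 ^\<^sub>m b')) *\<^sub>v \<phi>\<^sub>0 \<theta>\<^sub>2)))\<^sup>2 = 1 / 7"
  proof (intro ballI impI)
    fix a b a' b' :: nat
    assume *: "a \<in> {0..5}" "b \<in> {0..5}" "a' \<in> {0..5}" "b' \<in> {0..5}" "(a, b) \<noteq> (a', b')"
    have "braket (\<phi>\<^sub>0 \<theta>\<^sub>2) ((mat_adjoint (X\<^sub>6 ^\<^sub>m a * Z\<^sub>6 ^\<^sub>m b) * (X\<^sub>6 ^\<^sub>m a' * Z\<^sub>6 ^\<^sub>m b')) *\<^sub>v \<phi>\<^sub>0 \<theta>\<^sub>2)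
      = braket (orbit \<theta>\<^sub>2 (int a) (int b)) (orbit \<theta>\<^sub>2 (int a') (int b'))"
      \<comment> \<open>The adjoint factor is moved to the left side of the bracket, leaving the
        inner product of two orbit vectors.\<close>
      unfolding assoc_mult_mat_vec[OF mat_adjoint_carrier[OF XZ] XZ \<phi>\<^sub>0_carrier]
      by (subst braket_adjoint[OF XZ \<phi>\<^sub>0_carrier])
        (simp_all add: XZ_orbit orbit_carrier)
    then show "(cmod (braket (\<phi>\<^sub>0 \<theta>\<^sub>2)
            ((mat_adjoint (X\<^sub>6 ^\<^sub>m a * Z\<^sub>6 ^\<^sub>m b) * (X\<^sub>6 ^\<^sub>m a' * Z\<^sub>6 ^\<^sub>m b')) *\<^sub>v \<phi>\<^sub>0 \<theta>\<^sub>2)))\<^sup>2 = 1 / 7"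
      using overlap[OF *] by simp
  qed
qed

end
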